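(* Let $X$ be a computable metric space. Then $\mathsf{C}_{\mathcal{K}(X)}\leq_{\mathrm{sW}}\widehat{\mathsf{LLPO}}$. If $X$ is rich, i.e. if there is a computable embedding $\iota:\{0,1\}^{\mathbb{N}}\hookrightarrow X$, then $\mathsf{C}_{\mathcal{K}(X)}\equiv_{\mathrm{sW}}\widehat{\mathsf{LLPO}}$.
   Context: A represented space $(X,\delta_X)$ is a set $X$ with a surjective partial map $\delta_X:\subseteq\mathbb{N}^{\mathbb{N}}\to X$. A multi-valued function $f:\subseteq X\rightrightarrows Y$ assigns to each $x$ a set $f(x)\subseteq Y$, with $\mathrm{dom}(f)=\{x: f(x)\neq\emptyset\}$. A realizer of $f$ is a partial $F:\subseteq\mathbb{N}^{\mathbb{N}}\to\mathbb{N}^{\mathbb{N}}$ such that $F(p)$ is defined and $\delta_YF(p)\in f(\delta_X(p))$ whenever $\delta_X(p)\in\mathrm{dom}(f)$. A function is computable if it has a computable realizer; a computable embedding is an injective computable map that is a topological embedding. Strong Weihrauch reducibility: $f\leq_{\mathrm{sW}}g$ iff there are computable $H,K:\subseteq\mathbb{N}^{\mathbb{N}}\to\mathbb{N}^{\mathbb{N}}$ such that $H\circ G\circ K$ is a realizer of $f$ for every realizer $G$ of $g$; $f\equiv_{\mathrm{sW}}g$ means both reductions hold. A computable metric space $(X,d,\alpha)$ is a metric space $(X,d)$ with a dense sequence $\alpha:\mathbb{N}\to X$ such that $(i,j)\mapsto d(\alpha(i),\alpha(j))$ is a computable double sequence of reals. It is represented by the Cauchy representation: $p$ names $x$ iff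 $d(\alpha(p(i)),\alpha(p(j)))\leq2^{-j}$ for all $i>j$ and $\alpha(p(i))\to x$. $\mathcal{K}_-(X)$ is the set of compact subsets of $X$ with the negative information representation $\kappa_-$: a name of $K$ is an enumeration of (codes of) all finite families of rational open balls (centers in the given dense sequence, rational radii) whose union covers $K$. Compact choice is the multi-valued function $\mathsf{C}_{\mathcal{K}(X)}:\subseteq\mathcal{K}_-(X)\rightrightarrows X$, $A\mapsto A$, with domain the non-empty compact subsets of $X$ (given a non-empty compact set $A$, any element of $A$ is an admissible output). $\mathsf{LLPO}:\subseteq\mathbb{N}^{\mathbb{N}}\rightrightarrows\mathbb{N}$ has domain $\{p: p(k)\neq0\text{ for at most one }k\}$ and values in $\{0,1\}$, with $0\in\mathsf{LLPO}(p)\iff(\forall n)\,p(2n)=0$ and $1\in\mathsf{LLPO}(p)\iff(\forall n)\,p(2n+1)=0$. $\widehat{\mathsf{LLPO}}:\subseteq\mathbb{N}^{\mathbb{N}}\rightrightarrows\mathbb{N}^{\mathbb{N}}$ is $\widehat{\mathsf{LLPO}}\langle p_0,p_1,\dots\rangle=\{q:(\forall k)\,q(k)\in\mathsf{LLPO}(p_k)\}$, defined when all $p_k\in\mathrm{dom}(\mathsf{LLPO})$, where $\langle p_0,p_1,\dots\rangle\langle k,n\rangle=p_k(n)$. $\mathbb{N}^{\mathbb{N}}$ and $\{0,1\}^{\mathbb{N}}$ are represented by the identity. *)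

theory Defs
  imports "HOL-Analysis.Analysis" "HOL-Library.Nat_Bijection"
begin

section \<open>Computability on Baire space\<close>

type_synonym baire = "nat \<Rightarrow> nat"

text \<open>
  Unbounded search is strict: all values below the zero have to be defined.
\<close>

definition least_zero :: "(nat \<rightharpoonup> nat) \<Rightarrow> nat \<Rightarrow> bool" where
  "least_zero g n \<longleftrightarrow> g n = Some 0 \<and> (\<forall>m<n. \<exists>v. g m = Some (Suc v))"

definition minimize :: "(nat \<rightharpoonup> nat) \<rightharpoonup> nat" where
  "minimize g = (if \<exists>n. least_zero g n then Some (THE n. least_zero g n) else None)"

text \<open>
  The partial recursive functionals of an oracle \<open>p\<close> and a list of numbers (Kleene's schemes:
  the functions that oracle Turing machines compute). A functional accepts argument lists of
  every length; \<open>None\<close> is divergence, or a list too short for the scheme.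
\<close>

inductive partial_recursive :: "(baire \<Rightarrow> nat list \<rightharpoonup> nat) \<Rightarrow> bool" where
  zero: "partial_recursive (\<lambda>p xs. Some 0)"
| succ: "partial_recursive (\<lambda>p xs. case xs of [] \<Rightarrow> None | x # _ \<Rightarrow> Some (Suc x))"
| proj: "partial_recursive (\<lambda>p xs. if i < length xs then Some (xs ! i) else None)"
| query: "partial_recursive (\<lambda>p xs. case xs of [] \<Rightarrow> None | x # _ \<Rightarrow> Some (p x))"
| comp: "\<lbrakk>partial_recursive f; \<forall>g \<in> set gs. partial_recursive g\<rbrakk> \<Longrightarrow>
    partial_recursive (\<lambda>p xs. Option.bind (those (map (\<lambda>g. g p xs) gs)) (f p))"
| prim_rec: "\<lbrakk>partial_recursive f; partial_recursive g\<rbrakk> \<Longrightarrow>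
    partial_recursive (\<lambda>p xs. case xs of [] \<Rightarrow> None
      | n # ys \<Rightarrow> rec_nat (f p ys) (\<lambda>k r. Option.bind r (\<lambda>v. g p (k # v # ys))) n)"
| search: "partial_recursive f \<Longrightarrow>
    partial_recursive (\<lambda>p xs. minimize (\<lambda>n. f p (n # xs)))"

text \<open>
  As usual in computable analysis, a partial function on Baire space is computable if some
  machine computes it on its domain; nothing is required outside the domain.
\<close>

definition computable_fun :: "(baire \<rightharpoonup> baire) \<Rightarrow> bool" where
  "computable_fun F \<longleftrightarrow>
     (\<exists>\<Phi>. partial_recursive \<Phi> \<and> (\<forall>p q. F p = Some q \<longrightarrow> (\<forall>n. \<Phi> p [n] = Some (q n))))"

text \<open>
  Computability without an oracle: the functional gives the same result for every oracle. This is
  ordinary computability, since the oracle may be replaced by the constant zero function.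
\<close>

definition computable_nat3 :: "(nat \<Rightarrow> nat \<Rightarrow> nat \<Rightarrow> nat) \<Rightarrow> bool" where
  "computable_nat3 f \<longleftrightarrow>
     (\<exists>\<Phi>. partial_recursive \<Phi> \<and> (\<forall>p i j n. \<Phi> p [i, j, n] = Some (f i j n)))"

section \<open>Represented spaces and Weihrauch reducibility\<close>

text \<open>
  A representation is a partial map \<open>\<delta>\<close> on Baire space; the represented set is \<^term>\<open>ran \<delta>\<close>,
  so that \<open>\<delta>\<close> is surjective onto it.
\<close>

type_synonym 'a representation = "baire \<rightharpoonup> 'a"

text \<open>
  A multi-valued function is a set-valued function; its domain is the set of arguments with a
  non-empty value.
\<close>

type_synonym ('a, 'b) multifun = "'a \<Rightarrow> 'b set"

definition mdom :: "('a, 'b) multifun \<Rightarrow> 'a set" where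
  "mdom f = {x. f x \<noteq> {}}"

definition realizer ::
  "'a representation \<Rightarrow> 'b representation \<Rightarrow> ('a, 'b) multifun \<Rightarrow> (baire \<rightharpoonup> baire) \<Rightarrow> bool" where
  "realizer \<delta>X \<delta>Y f F \<longleftrightarrow>
     (\<forall>p x. \<delta>X p = Some x \<and> x \<in> mdom f \<longrightarrow>
        (\<exists>q y. F p = Some q \<and> \<delta>Y q = Some y \<and> y \<in> f x))"

definition computable_map :: "'a representation \<Rightarrow> 'b representation \<Rightarrow> ('a \<Rightarrow> 'b) \<Rightarrow> bool" where
  "computable_map \<delta>X \<delta>Y f \<longleftrightarrow> (\<exists>F. computable_fun F \<and> realizer \<delta>X \<delta>Y (\<lambda>x. {f x}) F)"

definition sW_reducible ::
  "'a representation \<Rightarrow> 'b representation \<Rightarrow> ('a, 'b) multifun \<Rightarrow>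
   'c representation \<Rightarrow> 'd representation \<Rightarrow> ('c, 'd) multifun \<Rightarrow> bool" where
  "sW_reducible \<delta>X \<delta>Y f \<delta>Z \<delta>W g \<longleftrightarrow>
     (\<exists>H K. computable_fun H \<and> computable_fun K \<and>
        (\<forall>G. realizer \<delta>Z \<delta>W g G \<longrightarrow> realizer \<delta>X \<delta>Y f (H \<circ>\<^sub>m G \<circ>\<^sub>m K)))"

definition sW_equivalent ::
  "'a representation \<Rightarrow> 'b representation \<Rightarrow> ('a, 'b) multifun \<Rightarrow>
   'c representation \<Rightarrow> 'd representation \<Rightarrow> ('c, 'd) multifun \<Rightarrow> bool" where
  "sW_equivalent \<delta>X \<delta>Y f \<delta>Z \<delta>W g \<longleftrightarrow>
     sW_reducible \<delta>X \<delta>Y f \<delta>Z \<delta>W g \<and> sW_reducible \<delta>Z \<delta>W g \<delta>X \<delta>Y f"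

definition baire_rep :: "baire representation" where
  "baire_rep p = Some p"

definition cantor :: "baire set" where
  "cantor = {p. \<forall>n. p n \<in> {0, 1}}"

definition cantor_rep :: "baire representation" where
  "cantor_rep p = (if p \<in> cantor then Some p else None)"

section \<open>Computable metric spaces\<close>

text \<open>The numbering \<open>\<langle>i, \<langle>j, k\<rangle>\<rangle> \<mapsto> (i - j) / (k + 1)\<close> of the rational numbers.\<close>

definition rational_of :: "nat \<Rightarrow> real" where
  "rational_of c = (case prod_decode c of (i, jk) \<Rightarrow>
     case prod_decode jk of (j, k) \<Rightarrow> (real i - real j) / real (Suc k))"

definition computable_real_double_seq :: "(nat \<Rightarrow> nat \<Rightarrow> real) \<Rightarrow> bool" where
  "computable_real_double_seq x \<longleftrightarrow>
     (\<exists>c. computable_nat3 c \<and> (\<forall>i j n. \<bar>x i j - rational_of (c i j n)\<bar> \<le> (1 / 2) ^ n))"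

definition computable_metric_space :: "(nat \<Rightarrow> 'a::metric_space) \<Rightarrow> bool" where
  "computable_metric_space \<alpha> \<longleftrightarrow>
     closure (range \<alpha>) = UNIV \<and> computable_real_double_seq (\<lambda>i j. dist (\<alpha> i) (\<alpha> j))"

definition cauchy_name :: "(nat \<Rightarrow> 'a::metric_space) \<Rightarrow> baire \<Rightarrow> 'a \<Rightarrow> bool" where
  "cauchy_name \<alpha> p x \<longleftrightarrow>
     (\<forall>i j. i > j \<longrightarrow> dist (\<alpha> (p i)) (\<alpha> (p j)) \<le> (1 / 2) ^ j) \<and> (\<lambda>i. \<alpha> (p i)) \<longlonglongrightarrow> x"

definition cauchy_rep :: "(nat \<Rightarrow> 'a::metric_space) \<Rightarrow> 'a representation" where
  "cauchy_rep \<alpha> p =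
     (if \<exists>x. cauchy_name \<alpha> p x then Some (THE x. cauchy_name \<alpha> p x) else None)"

text \<open>
  The code \<open>\<langle>n, \<langle>i, k\<rangle>\<rangle>\<close> denotes the ball of centre \<open>\<alpha> n\<close> and radius \<open>(i + 1) / (k + 1)\<close>, so the
  radii are exactly the positive rationals; a finite family of balls is coded by \<^const>\<open>list_encode\<close>.
\<close>

definition rational_ball :: "(nat \<Rightarrow> 'a::metric_space) \<Rightarrow> nat \<Rightarrow> 'a set" where
  "rational_ball \<alpha> c = (case prod_decode c of (n, ik) \<Rightarrow>
     case prod_decode ik of (i, k) \<Rightarrow> ball (\<alpha> n) (real (Suc i) / real (Suc k)))"

definition family_union :: "(nat \<Rightarrow> 'a::metric_space) \<Rightarrow> nat \<Rightarrow> 'a set" where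
  "family_union \<alpha> c = (\<Union>b \<in> set (list_decode c). rational_ball \<alpha> b)"

definition compact_name :: "(nat \<Rightarrow> 'a::metric_space) \<Rightarrow> baire \<Rightarrow> 'a set \<Rightarrow> bool" where
  "compact_name \<alpha> p K \<longleftrightarrow> compact K \<and> range p = {c. K \<subseteq> family_union \<alpha> c}"

definition compact_rep :: "(nat \<Rightarrow> 'a::metric_space) \<Rightarrow> 'a set representation" where
  "compact_rep \<alpha> p =
     (if \<exists>K. compact_name \<alpha> p K then Some (THE K. compact_name \<alpha> p K) else None)"

definition compact_choice :: "('a::topological_space set, 'a) multifun" where
  "compact_choice A = (if compact A then A else {})"

definition computable_cantor_embedding ::
  "(nat \<Rightarrow> 'a::metric_space) \<Rightarrow> (baire \<Rightarrow> 'a) \<Rightarrow> bool" where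
  "computable_cantor_embedding \<alpha> \<iota> \<longleftrightarrow>
     inj_on \<iota> cantor \<and> computable_map cantor_rep (cauchy_rep \<alpha>) \<iota> \<and>
     embedding_map (top_of_set cantor) euclidean \<iota>"

definition rich :: "(nat \<Rightarrow> 'a::metric_space) \<Rightarrow> bool" where
  "rich \<alpha> \<longleftrightarrow> (\<exists>\<iota>. computable_cantor_embedding \<alpha> \<iota>)"

section \<open>LLPO and its parallelization\<close>

definition LLPO :: "(baire, nat) multifun" where
  "LLPO p = (if \<forall>k l. p k \<noteq> 0 \<and> p l \<noteq> 0 \<longrightarrow> k = l
     then {i. i = 0 \<and> (\<forall>n. p (2 * n) = 0) \<or> i = 1 \<and> (\<forall>n. p (2 * n + 1) = 0)}
     else {})"

definition component :: "baire \<Rightarrow> nat \<Rightarrow> baire" where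
  "component p k = (\<lambda>n. p (prod_encode (k, n)))"

definition LLPO_hat :: "(baire, baire) multifun" where
  "LLPO_hat p = {q. (\<forall>k. component p k \<in> mdom LLPO) \<and> (\<forall>k. q k \<in> LLPO (component p k))}"

section \<open>The representations are well defined and surjective\<close>

lemma minimize_eq_Some_iff: "minimize g = Some n \<longleftrightarrow> least_zero g n"
proof -
  have uniq: "a = b" if "least_zero g a" "least_zero g b" for a b
    using that unfolding least_zero_def
    by (metis nat.distinct(1) nat_neq_iff option.inject)
  have "(THE n. least_zero g n) = n" if "least_zero g n" for n
    using that uniq by blast
  then show ?thesis unfolding minimize_def by auto
qed

lemma cauchy_rep_eq_Some_iff: "cauchy_rep \<alpha> p = Some x \<longleftrightarrow> cauchy_name \<alpha> p x"
proof -
  have uniq: "a = b" if "cauchy_name \<alpha> p a" "cauchy_name \<alpha> p b" for a b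
    using that LIMSEQ_unique unfolding cauchy_name_def by blast
  have "(THE n. cauchy_name \<alpha> p n) = n" if "cauchy_name \<alpha> p n" for n
    using that uniq by blast
  then show ?thesis unfolding cauchy_rep_def by auto
qed

lemma dense_point:
  assumes "closure (range \<alpha>) = UNIV" "e > 0"
  shows "\<exists>n. dist (\<alpha> n) x < e"
proof -
  have "x \<in> closure (range \<alpha>)" using assms(1) by simp
  then show ?thesis using assms(2) unfolding closure_approachable by blast
qed

lemma ran_cauchy_rep:
  fixes \<alpha> :: "nat \<Rightarrow> 'a::metric_space"
  assumes dense: "closure (range \<alpha>) = UNIV"
  shows "ran (cauchy_rep \<alpha>) = UNIV"
proof -
  have "\<exists>p. cauchy_name \<alpha> p x" for x
  proof -
    have "\<forall>i. \<exists>n. dist (\<alpha> n) x < (1/2) ^ Suc i"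
      by (intro allI dense_point[OF dense]) simp
    then obtain p where p: "\<And>i. dist (\<alpha> (p i)) x < (1/2) ^ Suc i" by metis
    have "dist (\<alpha> (p i)) (\<alpha> (p j)) \<le> (1 / 2) ^ j" if "i > j" for i j
    proof -
      have "(1/2::real) ^ Suc i \<le> (1/2) ^ Suc j"
        using that by (intro power_decreasing) auto
      then have "dist (\<alpha> (p i)) x + dist (\<alpha> (p j)) x \<le> (1/2) ^ Suc j + (1/2) ^ Suc j"
        using p[of i] p[of j] by linarith
      then show ?thesis using dist_triangle2[of "\<alpha> (p i)" "\<alpha> (p j)" x] by simp
    qed
    moreover have "(\<lambda>i. \<alpha> (p i)) \<longlonglongrightarrow> x"
    proof -
      have "(\<lambda>i. (1/2::real) ^ Suc i) \<longlonglongrightarrow> 0"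
        by (rule LIMSEQ_Suc, rule LIMSEQ_power_zero) simp
      moreover have "\<forall>\<^sub>F i in sequentially. norm (dist (\<alpha> (p i)) x) \<le> (1/2) ^ Suc i"
        using p by (intro always_eventually) (auto simp: less_imp_le)
      ultimately have "(\<lambda>i. dist (\<alpha> (p i)) x) \<longlonglongrightarrow> 0"
        by (rule Lim_null_comparison[rotated])
      then show ?thesis by (subst tendsto_dist_iff)
    qed
    ultimately show ?thesis unfolding cauchy_name_def by blast
  qed
  then show ?thesis unfolding ran_def by (auto simp: cauchy_rep_eq_Some_iff)
qed

lemma rational_ball_encode:
  "rational_ball \<alpha> (prod_encode (n, prod_encode (i, k))) = ball (\<alpha> n) (real (Suc i) / real (Suc k))"
  by (simp add: rational_ball_def)

lemma compact_avoid_cover: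
  fixes \<alpha> :: "nat \<Rightarrow> 'a::metric_space"
  assumes dense: "closure (range \<alpha>) = UNIV" and K: "compact K" and x: "x \<notin> K"
  shows "\<exists>c. K \<subseteq> family_union \<alpha> c \<and> x \<notin> family_union \<alpha> c"
proof -
  have "\<exists>b. y \<in> rational_ball \<alpha> b \<and> x \<notin> rational_ball \<alpha> b" if "y \<in> K" for y
  proof -
    have "dist x y > 0" using that x by auto
    then obtain k where k: "1 / real (Suc k) < dist x y / 2"
      using nat_approx_posE[of "dist x y / 2"] by auto
    obtain n where n: "dist (\<alpha> n) y < 1 / real (Suc k)"
      using dense_point[OF dense, of "1 / real (Suc k)" y] by auto
    have "dist x y \<le> dist (\<alpha> n) x + dist (\<alpha> n) y"
      by (rule dist_triangle3)
    then have "\<not> dist (\<alpha> n) x < 1 / real (Suc k)" using n k by linarith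
    then have "y \<in> rational_ball \<alpha> (prod_encode (n, prod_encode (0, k)))"
      "x \<notin> rational_ball \<alpha> (prod_encode (n, prod_encode (0, k)))"
      using n unfolding rational_ball_encode by auto
    then show ?thesis by blast
  qed
  then obtain b where b: "\<And>y. y \<in> K \<Longrightarrow> y \<in> rational_ball \<alpha> (b y) \<and> x \<notin> rational_ball \<alpha> (b y)"
    by metis
  have "open (rational_ball \<alpha> c)" for c
    by (auto simp: rational_ball_def split: prod.split)
  moreover have "K \<subseteq> (\<Union>y\<in>K. rational_ball \<alpha> (b y))" using b by blast
  ultimately obtain C where C: "C \<subseteq> K" "finite C" "K \<subseteq> (\<Union>y\<in>C. rational_ball \<alpha> (b y))"
    using compactE_image[OF K, of K "\<lambda>y. rational_ball \<alpha> (b y)"] by metis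
  obtain bs where bs: "set bs = b ` C" using C(2) finite_list[of "b ` C"] by auto
  have "family_union \<alpha> (list_encode bs) = (\<Union>y\<in>C. rational_ball \<alpha> (b y))"
    by (simp add: family_union_def bs)
  moreover have "x \<notin> (\<Union>y\<in>C. rational_ball \<alpha> (b y))" using C(1) b by blast
  ultimately show ?thesis using C(3) by (intro exI[of _ "list_encode bs"]) simp
qed

lemma compact_rep_eq_Some_iff:
  assumes dense: "closure (range \<alpha>) = UNIV"
  shows "compact_rep \<alpha> p = Some K \<longleftrightarrow> compact_name \<alpha> p K"
proof -
  have sub: "A \<subseteq> B" if A: "compact_name \<alpha> p A" and B: "compact_name \<alpha> p B" for A B
  proof
    fix x assume "x \<in> A"
    show "x \<in> B"
    proof (rule ccontr)
      assume "x \<notin> B"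
      moreover have "compact B" using B by (simp add: compact_name_def)
      ultimately obtain c where "B \<subseteq> family_union \<alpha> c" "x \<notin> family_union \<alpha> c"
        using compact_avoid_cover[OF dense] by metis
      moreover have "{c. A \<subseteq> family_union \<alpha> c} = {c. B \<subseteq> family_union \<alpha> c}"
        using A B unfolding compact_name_def by simp
      ultimately show False using \<open>x \<in> A\<close> by blast
    qed
  qed
  have "(THE n. compact_name \<alpha> p n) = n" if "compact_name \<alpha> p n" for n
    using that sub by (intro the_equality subset_antisym)
  then show ?thesis unfolding compact_rep_def by auto
qed

lemma ran_compact_rep:
  fixes \<alpha> :: "nat \<Rightarrow> 'a::metric_space"
  assumes dense: "closure (range \<alpha>) = UNIV"
  shows "ran (compact_rep \<alpha>) = {K. compact K}"
proof -
  have "\<exists>p. compact_name \<alpha> p K" if K: "compact K" for K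
  proof -
    have ne: "{c. K \<subseteq> family_union \<alpha> c} \<noteq> {}"
    proof -
      obtain r where r: "K \<subseteq> ball (\<alpha> 0) r"
        using compact_imp_bounded[OF K] bounded_subset_ballD by blast
      obtain m where m: "r \<le> real m" using real_arch_simple by blast
      have "family_union \<alpha> (list_encode [prod_encode (0, prod_encode (m, 0))])
          = ball (\<alpha> 0) (real (Suc m))"
        by (simp add: family_union_def rational_ball_encode)
      moreover have "ball (\<alpha> 0) r \<subseteq> ball (\<alpha> 0) (real (Suc m))"
        using m by (intro subset_ball) simp
      ultimately show ?thesis using r by blast
    qed
    have "countable {c. K \<subseteq> family_union \<alpha> c}" by simp
    then obtain p :: baire where "range p = {c. K \<subseteq> family_union \<alpha> c}"
      using range_from_nat_into[OF ne] by blast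
    then show ?thesis using K unfolding compact_name_def by blast
  qed
  then show ?thesis
    unfolding ran_def by (auto simp: compact_rep_eq_Some_iff[OF dense] compact_name_def)
qed

lemma ran_baire_rep: "ran baire_rep = UNIV"
  unfolding ran_def baire_rep_def by auto

lemma ran_cantor_rep: "ran cantor_rep = cantor"
  unfolding ran_def cantor_rep_def by auto

end

theory Submission
  imports Defs
begin

text \<open>
  A name of a compact set enumerates its finite covers by rational balls, so emptiness of the
  intersection of a compact set with closed conditions is semidecidable: a finite cover in the
  name consists of balls that each violate one of the conditions.

  For the reduction to the parallelization of LLPO, a point of the compact set is determined by answers to the
  questions, for all \<open>i\<close> and \<open>k\<close>, whether it is at distance at most \<open>2\<^sup>-\<^sup>k\<close> or at least \<open>2\<^sup>-\<^sup>k\<close> from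
  \<open>\<alpha> i\<close>. Both alternatives are closed and one of them always holds. LLPO may be asked, for every
  finite list of previous answers, which answer to the next question keeps the intersection
  non-empty: a wrong answer is refuted at a finite stage, and the first refutation found is written
  on the side of the answer that it rules out (\<open>answer_alive\<close>). The answers along the resulting
  path hold simultaneously at a point of the set by compactness (\<open>path_point\<close>). A Cauchy name of
  the point is read off from the answers alone, by searching for a centre that has been declared
  close (\<open>centres_cauchy_name\<close>). Because the binary questions range over all centres, the covers
  in the name never have to be communicated to the second half of the reduction.

  Conversely, let \<open>\<iota>\<close> embed Cantor space computably. The solutions of an instance of parallel
  LLPO form a non-empty product of finite sets, and being no solution is witnessed by one
  digit. A family of balls covers the image of the solutions if and only if some level \<open>L\<close> exists at
  which each binary word of length \<open>L\<close> is either ruled out as a prefix of a solution or mapped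
  into a ball of the family (\<open>covered_sound\<close>, \<open>covered_complete\<close>). Hence a name of the image can be
  computed, and compact choice selects the image of a solution. The digits of the solution
  are recovered by excluding the words with the opposite digit in the same manner
  (\<open>excluded_sound\<close>, \<open>excluded_complete\<close>). Both arguments rest on compactness of Cantor space
  (\<open>fan_principle\<close>) and on the fact that a computation on an infinite oracle is approximated by
  recursive finite stages that use finite prefixes (\<open>partial_recursive_simulation\<close>).
\<close>

section \<open>Total recursive functionals of fixed arity\<close>

text \<open>
  The closure properties are stated for functions of the whole argument list rather than for
  Kleene's schemes, so that an expression such as \<^term>\<open>xs ! 0 + xs ! 1\<close> is analysed
  syntactically.
\<close>

definition total_recursive :: "nat \<Rightarrow> (baire \<Rightarrow> nat list \<Rightarrow> nat) \<Rightarrow> bool" where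
  "total_recursive N f \<longleftrightarrow>
     (\<exists>\<Phi>. partial_recursive \<Phi> \<and> (\<forall>p xs. length xs = N \<longrightarrow> \<Phi> p xs = Some (f p xs)))"

lemma total_recursiveI:
  assumes "partial_recursive \<Phi>" "\<And>p xs. length xs = N \<Longrightarrow> \<Phi> p xs = Some (f p xs)"
  shows "total_recursive N f"
  using assms unfolding total_recursive_def by blast

lemma those_map_Some: "(\<And>x. x \<in> set xs \<Longrightarrow> f x = Some (g x)) \<Longrightarrow> those (map f xs) = Some (map g xs)"
  by (induction xs) auto

lemma total_recursive_nth: "i < N \<Longrightarrow> total_recursive N (\<lambda>p xs. xs ! i)"
  by (rule total_recursiveI[OF partial_recursive.proj[of i]]) simp

lemma total_recursive_nth_drop: "k + i < N \<Longrightarrow> total_recursive N (\<lambda>p xs. drop k xs ! i)"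
  by (rule total_recursiveI[OF partial_recursive.proj[of "k + i"]]) simp

lemma total_recursive_comp:
  assumes "total_recursive (length gs) f" "\<forall>g \<in> set gs. total_recursive N g"
  shows "total_recursive N (\<lambda>p xs. f p (map (\<lambda>g. g p xs) gs))"
proof -
  obtain \<Phi> where \<Phi>: "partial_recursive \<Phi>" "\<And>p xs. length xs = length gs \<Longrightarrow> \<Phi> p xs = Some (f p xs)"
    using assms(1) unfolding total_recursive_def by blast
  obtain \<Psi> where \<Psi>: "\<And>g. g \<in> set gs \<Longrightarrow> partial_recursive (\<Psi> g) \<and>
      (\<forall>p xs. length xs = N \<longrightarrow> \<Psi> g p xs = Some (g p xs))"
    using assms(2) unfolding total_recursive_def by metis
  have *: "partial_recursive (\<lambda>p xs. Option.bind (those (map (\<lambda>g. g p xs) (map \<Psi> gs))) (\<Phi> p))"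
    using \<Phi>(1) \<Psi> by (intro partial_recursive.comp) auto
  have "those (map (\<lambda>g. g p xs) (map \<Psi> gs)) = Some (map (\<lambda>g. g p xs) gs)"
    if "length xs = N" for p xs
    unfolding map_map o_def using \<Psi> that by (intro those_map_Some) auto
  then show ?thesis using \<Phi>(2) by (intro total_recursiveI[OF *]) auto
qed

lemma total_recursive_comp1:
  assumes "total_recursive 1 (\<lambda>p xs. f p (xs ! 0))" "total_recursive N g"
  shows "total_recursive N (\<lambda>p xs. f p (g p xs))"
  using total_recursive_comp[of "[g]" "\<lambda>p xs. f p (xs ! 0)" N] assms by simp

lemma total_recursive_comp3:
  assumes "total_recursive 3 (\<lambda>p xs. f p (xs ! 0) (xs ! 1) (xs ! 2))"
    "total_recursive N g" "total_recursive N h" "total_recursive N k"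
  shows "total_recursive N (\<lambda>p xs. f p (g p xs) (h p xs) (k p xs))"
  using total_recursive_comp[of "[g, h, k]" "\<lambda>p xs. f p (xs ! 0) (xs ! 1) (xs ! 2)" N] assms
  by (simp add: numeral_3_eq_3)

lemma total_recursive_cong:
  assumes "total_recursive N f" "\<And>p xs. length xs = N \<Longrightarrow> f p xs = g p xs"
  shows "total_recursive N g"
  using assms unfolding total_recursive_def by metis

text \<open>
  Weakening: the step of a recursion sees the counter and the previous value in front of the
  arguments of the ambient function.
\<close>

lemma total_recursive_drop:
  assumes "total_recursive N f"
  shows "total_recursive (N + 2) (\<lambda>p xs. f p (drop 2 xs))"
proof -
  let ?gs = "map (\<lambda>i (p::baire) xs :: nat list. xs ! (i + 2)) [0..<N]"
  have "total_recursive (N + 2) (\<lambda>p xs. f p (map (\<lambda>g. g p xs) ?gs))"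
    using assms by (intro total_recursive_comp) (auto intro!: total_recursive_nth)
  moreover have "map (\<lambda>g. g p xs) ?gs = drop 2 xs" if "length xs = N + 2" for p :: baire and xs
    using that by (intro nth_equalityI) (auto simp: add.commute)
  ultimately show ?thesis using total_recursive_cong[of "N + 2"] by (metis (no_types, lifting))
qed

text \<open>
  The counter may be an arbitrary recursive expression; the scheme itself recurses on the first
  argument only, so the other arguments are handed to it by projections.
\<close>

lemma total_recursive_rec:
  assumes a: "total_recursive N a"
    and g: "total_recursive (N + 2) (\<lambda>p ys. g p (drop 2 ys) (ys ! 0) (ys ! 1))"
    and n: "total_recursive N n"
  shows "total_recursive N (\<lambda>p xs. rec_nat (a p xs) (g p xs) (n p xs))"
proof -
  obtain \<Phi> where \<Phi>: "partial_recursive \<Phi>" "\<And>p xs. length xs = N \<Longrightarrow> \<Phi> p xs = Some (a p xs)"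
    using a unfolding total_recursive_def by blast
  obtain \<Psi> where \<Psi>: "partial_recursive \<Psi>"
    "\<And>p xs. length xs = N + 2 \<Longrightarrow> \<Psi> p xs = Some (g p (drop 2 xs) (xs ! 0) (xs ! 1))"
    using g unfolding total_recursive_def by blast
  let ?\<Theta> = "\<lambda>p xs. case xs of [] \<Rightarrow> None
      | n # ys \<Rightarrow> rec_nat (\<Phi> p ys) (\<lambda>k r. Option.bind r (\<lambda>v. \<Psi> p (k # v # ys))) n"
  have "rec_nat (\<Phi> p ys) (\<lambda>k r. Option.bind r (\<lambda>v. \<Psi> p (k # v # ys))) m
      = Some (rec_nat (a p ys) (g p ys) m)" if "length ys = N" for p ys m
    using that \<Phi>(2) \<Psi>(2) by (induction m) auto
  then have "total_recursive (N + 1) (\<lambda>p xs. rec_nat (a p (tl xs)) (g p (tl xs)) (hd xs))"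
    by (intro total_recursiveI[OF partial_recursive.prim_rec[OF \<Phi>(1) \<Psi>(1)]]) (auto split: list.split)
  moreover let ?gs = "n # map (\<lambda>i (p::baire) xs :: nat list. xs ! i) [0..<N]"
  have "length ?gs = N + 1" by simp
  ultimately have "total_recursive N (\<lambda>p xs. rec_nat (a p (tl (map (\<lambda>g. g p xs) ?gs)))
      (g p (tl (map (\<lambda>g. g p xs) ?gs))) (hd (map (\<lambda>g. g p xs) ?gs)))"
    using n by (intro total_recursive_comp) (auto intro!: total_recursive_nth)
  moreover have "tl (map (\<lambda>g. g p xs) ?gs) = xs" if "length xs = N" for p :: baire and xs
    using that by (intro nth_equalityI) auto
  ultimately show ?thesis
    by (elim total_recursive_cong) simp
qed

lemma total_recursive_Suc: "total_recursive N f \<Longrightarrow> total_recursive N (\<lambda>p xs. Suc (f p xs))"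
  by (rule total_recursive_comp1, rule total_recursiveI[OF partial_recursive.succ])
    (auto split: list.split)

lemma total_recursive_query: "total_recursive N f \<Longrightarrow> total_recursive N (\<lambda>p xs. p (f p xs))"
  by (rule total_recursive_comp1, rule total_recursiveI[OF partial_recursive.query])
    (auto split: list.split)

lemma total_recursive_const: "total_recursive N (\<lambda>p xs. c)"
proof (induction c)
  case 0
  show ?case by (rule total_recursiveI[OF partial_recursive.zero]) simp
qed (rule total_recursive_Suc)

lemma total_recursive_add:
  assumes f: "total_recursive N f" and g: "total_recursive N g"
  shows "total_recursive N (\<lambda>p xs. f p xs + g p xs)"
proof -
  have eq: "rec_nat x (\<lambda>k r. Suc r) y = x + y" for x y :: nat by (induction y) auto
  have "total_recursive N (\<lambda>p xs. rec_nat (f p xs) (\<lambda>k r. Suc r) (g p xs))"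
    by (intro total_recursive_rec f g total_recursive_Suc total_recursive_nth) simp
  then show ?thesis by (simp add: eq)
qed

lemma total_recursive_mult:
  assumes f: "total_recursive N f" and g: "total_recursive N g"
  shows "total_recursive N (\<lambda>p xs. f p xs * g p xs)"
proof -
  have eq: "rec_nat 0 (\<lambda>k r. r + x) y = x * y" for x y :: nat by (induction y) auto
  have "total_recursive N (\<lambda>p xs. rec_nat 0 (\<lambda>k r. r + f p xs) (g p xs))"
    by (intro total_recursive_rec total_recursive_drop f g total_recursive_const
        total_recursive_add total_recursive_nth) simp
  then show ?thesis by (simp add: eq)
qed

lemma total_recursive_diff:
  assumes f: "total_recursive N f" and g: "total_recursive N g"
  shows "total_recursive N (\<lambda>p xs. f p xs - g p xs)"
proof -
  have eq1: "rec_nat 0 (\<lambda>k r. k) y = y - 1" for y :: nat by (cases y) auto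
  have eq2: "rec_nat x (\<lambda>k r. r - 1) y = x - y" for x y :: nat by (induction y) auto
  have "total_recursive M (\<lambda>p xs. rec_nat 0 (\<lambda>k r. k) (h p xs))" if h: "total_recursive M h" for M h
    by (intro total_recursive_rec h total_recursive_const total_recursive_nth) simp
  then have pred: "total_recursive M (\<lambda>p xs. h p xs - 1)" if h: "total_recursive M h" for M h
    unfolding eq1 using h by blast
  have "total_recursive N (\<lambda>p xs. rec_nat (f p xs) (\<lambda>k r. r - 1) (g p xs))"
    by (intro total_recursive_rec f g pred total_recursive_nth) simp
  then show ?thesis unfolding eq2 .
qed

lemma total_recursive_if_zero:
  assumes f: "total_recursive N f" and g: "total_recursive N g" and h: "total_recursive N h"
  shows "total_recursive N (\<lambda>p xs. if f p xs = 0 then g p xs else h p xs)"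
proof -
  have eq: "rec_nat x (\<lambda>k r. y) m = (if m = 0 then x else y)" for x y m :: nat by (cases m) auto
  have "total_recursive N (\<lambda>p xs. rec_nat (g p xs) (\<lambda>k r. h p xs) (f p xs))"
    by (intro total_recursive_rec total_recursive_drop f g h)
  then show ?thesis by (simp add: eq)
qed

lemma total_recursive_triangle:
  assumes f: "total_recursive N f"
  shows "total_recursive N (\<lambda>p xs. triangle (f p xs))"
proof -
  have eq: "rec_nat 0 (\<lambda>k r. r + Suc k) y = triangle y" for y :: nat by (induction y) auto
  have "total_recursive N (\<lambda>p xs. rec_nat 0 (\<lambda>k r. r + Suc k) (f p xs))"
    by (intro total_recursive_rec f total_recursive_const total_recursive_Suc
        total_recursive_add total_recursive_nth) simp_all
  then show ?thesis unfolding eq .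
qed

lemma total_recursive_prod_encode:
  assumes "total_recursive N f" "total_recursive N g"
  shows "total_recursive N (\<lambda>p xs. prod_encode (f p xs, g p xs))"
  unfolding prod_encode_def
  using assms by (auto intro!: total_recursive_add total_recursive_triangle)

abbreviation pfst :: "nat \<Rightarrow> nat" where "pfst n \<equiv> fst (prod_decode n)"
abbreviation psnd :: "nat \<Rightarrow> nat" where "psnd n \<equiv> snd (prod_decode n)"

text \<open>
  The pair with code \<^term>\<open>n\<close> lies on the diagonal whose number is the largest \<^term>\<open>d\<close> with
  \<^term>\<open>triangle d \<le> n\<close>. Primitive recursion finds it, because it grows by at most one in each step; the
  usual recursion equations of unpairing would need a pair as intermediate value.
\<close>

definition diagonal :: "nat \<Rightarrow> nat" where
  "diagonal n = rec_nat 0 (\<lambda>k r. if triangle (Suc r) - Suc k = 0 then Suc r else r) n"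

lemma diagonal_bounds: "triangle (diagonal n) \<le> n \<and> n < triangle (Suc (diagonal n))"
  by (induction n) (auto simp: diagonal_def)

lemma triangle_mono: "a \<le> b \<Longrightarrow> triangle a \<le> triangle b"
  by (rule lift_Suc_mono_le[of triangle]) auto

lemma prod_decode_diagonal:
  "prod_decode n = (n - triangle (diagonal n), diagonal n - (n - triangle (diagonal n)))"
proof -
  obtain a b where ab: "prod_decode n = (a, b)" by fastforce
  then have "n = prod_encode (a, b)" by (metis prod_decode_inverse)
  then have n: "n = triangle (a + b) + a" by (simp add: prod_encode_def)
  have "\<not> a + b < diagonal n"
    using triangle_mono[of "Suc (a + b)" "diagonal n"] diagonal_bounds[of n] n by auto
  moreover have "\<not> diagonal n < a + b"
    using triangle_mono[of "Suc (diagonal n)" "a + b"] diagonal_bounds[of n] n by auto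
  ultimately have "diagonal n = a + b" by simp
  then show ?thesis using ab n by simp
qed

lemma total_recursive_diagonal:
  assumes "total_recursive N f"
  shows "total_recursive N (\<lambda>p xs. diagonal (f p xs))"
  unfolding diagonal_def
  by (intro total_recursive_rec assms total_recursive_const total_recursive_if_zero total_recursive_diff
      total_recursive_triangle total_recursive_Suc total_recursive_nth) simp_all

lemma total_recursive_pfst:
  assumes "total_recursive N f"
  shows "total_recursive N (\<lambda>p xs. pfst (f p xs))"
  unfolding prod_decode_diagonal fst_conv
  by (intro assms total_recursive_diff total_recursive_triangle total_recursive_diagonal)

lemma total_recursive_psnd:
  assumes "total_recursive N f"
  shows "total_recursive N (\<lambda>p xs. psnd (f p xs))"
  unfolding prod_decode_diagonal snd_conv
  by (intro assms total_recursive_diff total_recursive_triangle total_recursive_diagonal)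

section \<open>Recursive functions and decidable predicates\<close>

text \<open>
  With pairing one argument suffices, and the rules for bound variables take a uniform form: a
  function under a binder is recursive if it is so as a function of the pair of the ambient argument
  and the bound variable. The conclusions of the rules collected below are higher-order patterns, so
  that introduction steps follow the syntax of an expression.
\<close>

definition recursive :: "(baire \<Rightarrow> nat \<Rightarrow> nat) \<Rightarrow> bool" where
  "recursive f \<longleftrightarrow> total_recursive 1 (\<lambda>p xs. f p (xs ! 0))"

definition decidable :: "(baire \<Rightarrow> nat \<Rightarrow> bool) \<Rightarrow> bool" where
  "decidable P \<longleftrightarrow> recursive (\<lambda>p x. of_bool (P p x))"

named_theorems recursive_intros

lemma recursive_id [recursive_intros]: "recursive (\<lambda>p x. x)"
  unfolding recursive_def by (rule total_recursive_nth) simp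

lemma recursive_const [recursive_intros]: "recursive (\<lambda>p x. c)"
  unfolding recursive_def by (rule total_recursive_const)

lemma recursive_arith [recursive_intros]:
  assumes "recursive f"
  shows "recursive (\<lambda>p x. Suc (f p x))" "recursive (\<lambda>p x. p (f p x))"
    "recursive (\<lambda>p x. pfst (f p x))" "recursive (\<lambda>p x. psnd (f p x))"
  using assms unfolding recursive_def
  by (simp_all only: total_recursive_Suc total_recursive_query total_recursive_pfst total_recursive_psnd)

lemma recursive_arith2 [recursive_intros]:
  assumes "recursive f" "recursive g"
  shows "recursive (\<lambda>p x. f p x + g p x)" "recursive (\<lambda>p x. f p x * g p x)"
    "recursive (\<lambda>p x. f p x - g p x)" "recursive (\<lambda>p x. prod_encode (f p x, g p x))"
  using assms unfolding recursive_def
  by (simp_all only: total_recursive_add total_recursive_mult total_recursive_diff total_recursive_prod_encode)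

lemma recursive_comp: "recursive F \<Longrightarrow> recursive f \<Longrightarrow> recursive (\<lambda>p x. F p (f p x))"
  unfolding recursive_def by (rule total_recursive_comp1)

lemma recursive_comp_pair:
  assumes "recursive (\<lambda>p x. F p (pfst x) (psnd x))" "recursive f" "recursive g"
  shows "recursive (\<lambda>p x. F p (f p x) (g p x))"
  using recursive_comp[OF assms(1) recursive_arith2(4)[OF assms(2,3)]] by simp

lemma recursive_rec [recursive_intros]:
  assumes a: "recursive a" and n: "recursive n"
    and g: "recursive (\<lambda>p y. g p (pfst y) (pfst (psnd y)) (psnd (psnd y)))"
  shows "recursive (\<lambda>p x. rec_nat (a p x) (g p x) (n p x))"
proof -
  have "total_recursive (1 + 2) (\<lambda>p ys. (\<lambda>p y. g p (pfst y) (pfst (psnd y)) (psnd (psnd y))) p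
      (prod_encode (drop 2 ys ! 0, prod_encode (ys ! 0, ys ! 1))))"
    by (rule total_recursive_comp1[OF g[unfolded recursive_def]])
      (intro total_recursive_prod_encode total_recursive_nth total_recursive_nth_drop; simp)
  then show ?thesis
    unfolding recursive_def using a n by (intro total_recursive_rec) (auto simp: recursive_def)
qed

lemma recursive_if [recursive_intros]:
  assumes "decidable P" "recursive f" "recursive g"
  shows "recursive (\<lambda>p x. if P p x then f p x else g p x)"
proof -
  have "recursive (\<lambda>p x. if of_bool (P p x) = (0::nat) then g p x else f p x)"
    using assms unfolding recursive_def decidable_def by (intro total_recursive_if_zero)
  moreover have "(if of_bool b = (0::nat) then y else x) = (if b then x else y)" for b and x y :: nat
    by simp
  ultimately show ?thesis by simp
qed

lemma decidable_comp_pair: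
  assumes "decidable (\<lambda>p x. Q p (pfst x) (psnd x))" "recursive f" "recursive g"
  shows "decidable (\<lambda>p x. Q p (f p x) (g p x))"
  using recursive_comp_pair[OF assms(1)[unfolded decidable_def] assms(2,3)] unfolding decidable_def .

lemma decidable_eq_0: "recursive f \<Longrightarrow> decidable (\<lambda>p x. f p x = 0)"
  using total_recursive_if_zero[of 1 "\<lambda>p xs. f p (xs ! 0)" "\<lambda>p xs. 1" "\<lambda>p xs. 0"] total_recursive_const[of 1]
  unfolding recursive_def decidable_def by (simp add: of_bool_def)

lemma decidable_logic [recursive_intros]:
  assumes "decidable P" "decidable Q"
  shows "decidable (\<lambda>p x. P p x \<and> Q p x)" "decidable (\<lambda>p x. P p x \<or> Q p x)"
proof -
  have "recursive (\<lambda>p x. if P p x then of_bool (Q p x) else 0)"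
    "recursive (\<lambda>p x. if P p x then 1 else of_bool (Q p x))"
    using assms by (auto intro!: recursive_intros simp: decidable_def)
  moreover have "(if b then of_bool c else 0) = (of_bool (b \<and> c) :: nat)"
    "(if b then 1 else of_bool c) = (of_bool (b \<or> c) :: nat)" for b c by auto
  ultimately show "decidable (\<lambda>p x. P p x \<and> Q p x)" "decidable (\<lambda>p x. P p x \<or> Q p x)"
    unfolding decidable_def by simp_all
qed

lemma decidable_not [recursive_intros]: "decidable P \<Longrightarrow> decidable (\<lambda>p x. \<not> P p x)"
  using decidable_eq_0[of "\<lambda>p x. of_bool (P p x)"] by (simp add: decidable_def)

lemma decidable_compare [recursive_intros]:
  assumes f: "recursive f" and g: "recursive g"
  shows "decidable (\<lambda>p x. f p x \<le> g p x)" "decidable (\<lambda>p x. f p x < g p x)"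
    "decidable (\<lambda>p x. f p x = g p x)"
proof -
  have le: "decidable (\<lambda>p x. u p x \<le> v p x)" if "recursive u" "recursive v" for u v
    using decidable_eq_0[OF recursive_arith2(3)[OF that]] by simp
  show "decidable (\<lambda>p x. f p x \<le> g p x)" by (intro le f g)
  show "decidable (\<lambda>p x. f p x < g p x)"
    using decidable_not[OF le[OF g f]] by (simp add: not_le)
  show "decidable (\<lambda>p x. f p x = g p x)"
    using decidable_logic(1)[OF le[OF f g] le[OF g f]] by (simp add: eq_iff)
qed

lemma decidable_bounded_ex [recursive_intros]:
  assumes "decidable (\<lambda>p y. Q p (pfst y) (psnd y))" "recursive n"
  shows "decidable (\<lambda>p x. \<exists>j<n p x. Q p x j)"
proof -
  have eq: "rec_nat 0 (\<lambda>j r. if R j then 1 else r) m = (of_bool (\<exists>j<m. R j) :: nat)" for R m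
    by (induction m) (auto simp: less_Suc_eq)
  have "decidable (\<lambda>p y. Q p (pfst y) (pfst (psnd y)))"
    by (intro decidable_comp_pair[OF assms(1)] recursive_intros)
  then have "recursive (\<lambda>p x. rec_nat 0 (\<lambda>j r. if Q p x j then 1 else r) (n p x))"
    using assms(2) by (intro recursive_intros)
  then show ?thesis unfolding eq decidable_def .
qed

lemma decidable_bounded_all [recursive_intros]:
  assumes "decidable (\<lambda>p y. Q p (pfst y) (psnd y))" "recursive n"
  shows "decidable (\<lambda>p x. \<forall>j<n p x. Q p x j)"
proof -
  have "decidable (\<lambda>p x. \<not> (\<exists>j<n p x. \<not> Q p x j))"
    using assms by (intro recursive_intros)
  then show ?thesis by simp
qed

lemma recursive_power2 [recursive_intros]:
  assumes "recursive f"
  shows "recursive (\<lambda>p x. 2 ^ f p x)"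
proof -
  have eq: "rec_nat 1 (\<lambda>k r. 2 * r) n = (2::nat) ^ n" for n by (induction n) auto
  have "recursive (\<lambda>p x. rec_nat 1 (\<lambda>k r. 2 * r) (f p x))"
    using assms by (intro recursive_intros)
  then show ?thesis unfolding eq .
qed

lemma recursive_mod2 [recursive_intros]:
  assumes "recursive f"
  shows "recursive (\<lambda>p x. f p x mod 2)"
proof -
  have eq: "rec_nat 0 (\<lambda>k r. 1 - r) n = n mod (2::nat)" for n by (induction n) (auto, presburger)
  have "recursive (\<lambda>p x. rec_nat 0 (\<lambda>k r. 1 - r) (f p x))"
    using assms by (intro recursive_intros)
  then show ?thesis unfolding eq .
qed

lemma recursive_div2 [recursive_intros]:
  assumes "recursive f"
  shows "recursive (\<lambda>p x. f p x div 2)"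
proof -
  have eq: "rec_nat 0 (\<lambda>k r. r + k mod 2) n = n div (2::nat)" for n by (induction n) (auto, presburger)
  have "recursive (\<lambda>p x. rec_nat 0 (\<lambda>k r. r + k mod 2) (f p x))"
    using assms by (intro recursive_intros)
  then show ?thesis unfolding eq .
qed

definition digit :: "nat \<Rightarrow> nat \<Rightarrow> nat" where
  "digit w i = w div 2 ^ i mod 2"

lemma recursive_digit [recursive_intros]:
  assumes "recursive f" "recursive g"
  shows "recursive (\<lambda>p x. digit (f p x) (g p x))"
proof -
  have eq: "rec_nat w (\<lambda>k r. r div 2) n = w div 2 ^ n" for w n :: nat
    by (induction n) (auto simp: div_mult2_eq[symmetric] mult.commute)
  have "recursive (\<lambda>p x. rec_nat (f p x) (\<lambda>k r. r div 2) (g p x) mod 2)"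
    using assms by (intro recursive_intros)
  then show ?thesis unfolding eq digit_def .
qed

text \<open>
  Quantification over the entries of a coded list becomes bounded quantification over positions:
  the code bounds the length, and the entry at a position is the head of an iterated tail.
\<close>

definition tail_code :: "nat \<Rightarrow> nat \<Rightarrow> nat" where
  "tail_code c j = rec_nat c (\<lambda>k r. psnd (r - 1)) j"

lemma recursive_tail_code [recursive_intros]:
  assumes "recursive f" "recursive g"
  shows "recursive (\<lambda>p x. tail_code (f p x) (g p x))"
  unfolding tail_code_def using assms by (intro recursive_intros)

lemma list_decode_nonzero: "c \<noteq> 0 \<Longrightarrow> list_decode c = pfst (c - 1) # list_decode (psnd (c - 1))"
  by (cases c) (auto split: prod.split)

lemma list_decode_tail_code: "list_decode (tail_code c j) = drop j (list_decode c)"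
proof (induction j)
  case (Suc j)
  have "list_decode (psnd (n - 1)) = tl (list_decode n)" for n
  proof (cases n)
    case 0
    have "prod_encode (0, 0) = 0" by (simp add: prod_encode_def)
    then have "prod_decode 0 = (0, 0)" by (metis prod_encode_inverse)
    then show ?thesis using 0 by simp
  qed (auto split: prod.split)
  then show ?case using Suc by (simp add: tail_code_def drop_Suc tl_drop)
qed (simp add: tail_code_def)

lemma length_list_decode_le: "length (list_decode c) \<le> c"
proof (induction c rule: less_induct)
  case (less c)
  show ?case
  proof (cases c)
    case (Suc n)
    have "psnd n \<le> n" using le_prod_encode_2[of "psnd n" "pfst n"] by simp
    then have "length (list_decode (psnd n)) \<le> n" using less[of "psnd n"] Suc by simp
    then show ?thesis using Suc by (auto split: prod.split)
  qed simp
qed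

lemma list_decode_eq_Nil_iff: "list_decode c = [] \<longleftrightarrow> c = 0"
  by (cases c) (auto split: prod.split)

lemma tail_code_eq_0_iff: "tail_code c j = 0 \<longleftrightarrow> length (list_decode c) \<le> j"
  using list_decode_eq_Nil_iff[of "tail_code c j"] by (simp add: list_decode_tail_code)

lemma pfst_tail_code:
  assumes "j < length (list_decode c)"
  shows "pfst (tail_code c j - 1) = list_decode c ! j"
proof -
  have "tail_code c j \<noteq> 0" using assms by (simp add: tail_code_eq_0_iff)
  then have "hd (list_decode (tail_code c j)) = pfst (tail_code c j - 1)"
    by (simp add: list_decode_nonzero)
  then show ?thesis using assms by (simp add: list_decode_tail_code hd_drop_conv_nth)
qed

lemma decidable_list_ex [recursive_intros]:
  assumes Q: "decidable (\<lambda>p y. Q p (pfst y) (psnd y))" and c: "recursive c"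
  shows "decidable (\<lambda>p x. \<exists>b\<in>set (list_decode (c p x)). Q p x b)"
proof -
  have eq: "(\<exists>j<c. tail_code c j \<noteq> 0 \<and> R (pfst (tail_code c j - 1))) \<longleftrightarrow> (\<exists>b\<in>set (list_decode c). R b)"
    for c R
  proof -
    have "tail_code c j \<noteq> 0 \<and> R (pfst (tail_code c j - 1)) \<longleftrightarrow>
        j < length (list_decode c) \<and> R (list_decode c ! j)" for j
      using pfst_tail_code[of j c] by (auto simp: tail_code_eq_0_iff)
    then have "(\<exists>j<c. tail_code c j \<noteq> 0 \<and> R (pfst (tail_code c j - 1))) \<longleftrightarrow>
        (\<exists>j<length (list_decode c). R (list_decode c ! j))"
      using less_le_trans[OF _ length_list_decode_le[of c]] by blast
    also have "\<dots> \<longleftrightarrow> (\<exists>b\<in>set (list_decode c). R b)"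
      by (metis in_set_conv_nth)
    finally show ?thesis .
  qed
  have "decidable (\<lambda>p y. Q p (pfst y) (pfst (tail_code (c p (pfst y)) (psnd y) - 1)))"
    by (intro decidable_comp_pair[OF Q] recursive_intros recursive_comp[OF c])
  then have "decidable (\<lambda>p x. \<exists>j<c p x. tail_code (c p x) j \<noteq> 0 \<and> Q p x (pfst (tail_code (c p x) j - 1)))"
    by (intro recursive_intros c recursive_comp[OF c])
  then show ?thesis unfolding eq .
qed

lemma decidable_list_all [recursive_intros]:
  assumes "decidable (\<lambda>p y. Q p (pfst y) (psnd y))" "recursive c"
  shows "decidable (\<lambda>p x. \<forall>b\<in>set (list_decode (c p x)). Q p x b)"
proof -
  have "decidable (\<lambda>p x. \<not> (\<exists>b\<in>set (list_decode (c p x)). \<not> Q p x b))"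
    using assms by (intro recursive_intros)
  then show ?thesis by simp
qed

lemma recursive_nat3:
  assumes "computable_nat3 c" "recursive f" "recursive g" "recursive h"
  shows "recursive (\<lambda>p x. c (f p x) (g p x) (h p x))"
proof -
  obtain \<Phi> where \<Phi>: "partial_recursive \<Phi>" "\<And>p i j n. \<Phi> p [i, j, n] = Some (c i j n)"
    using assms(1) unfolding computable_nat3_def by blast
  have "xs = [xs ! 0, xs ! 1, xs ! 2]" if "length xs = 3" for xs :: "nat list"
    using that by (auto simp: numeral_3_eq_3 length_Suc_conv)
  then have "total_recursive 3 (\<lambda>p xs. c (xs ! 0) (xs ! 1) (xs ! 2))"
    using \<Phi> by (intro total_recursiveI[OF \<Phi>(1)]) metis
  then show ?thesis
    using assms(2-) unfolding recursive_def by (rule total_recursive_comp3)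
qed

lemma computable_fun_total:
  assumes "recursive f"
  shows "computable_fun (\<lambda>p. Some (f p))"
proof -
  obtain \<Phi> where "partial_recursive \<Phi>" "\<And>p xs. length xs = 1 \<Longrightarrow> \<Phi> p xs = Some (f p (xs ! 0))"
    using assms unfolding recursive_def total_recursive_def by blast
  then show ?thesis unfolding computable_fun_def by (intro exI[of _ \<Phi>]) auto
qed

text \<open>
  The only unbounded search: everything else in the two reductions is total, so that partiality is
  confined to one search in front of a total computation.
\<close>

lemma computable_fun_search:
  assumes P: "decidable (\<lambda>p y. P p (pfst y) (psnd y))"
    and g: "recursive (\<lambda>p y. g p (pfst y) (psnd y))"
  shows "computable_fun (\<lambda>p. if \<forall>n. \<exists>z. P p n z then Some (\<lambda>n. g p n (LEAST z. P p n z)) else None)"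
proof -
  have "recursive (\<lambda>p y. if P p (pfst y) (psnd y) then 0 else 1)"
    using P by (intro recursive_intros)
  note * = total_recursive_comp1[OF this[unfolded recursive_def], of 2
      "\<lambda>p xs. prod_encode (xs ! 1, xs ! 0)"]
  have "total_recursive 2 (\<lambda>p xs. if P p (xs ! 1) (xs ! 0) then 0 else 1)"
    using * by (simp add: total_recursive_prod_encode total_recursive_nth)
  then obtain \<Phi> where \<Phi>: "partial_recursive \<Phi>"
    "\<And>p xs. length xs = 2 \<Longrightarrow> \<Phi> p xs = Some (if P p (xs ! 1) (xs ! 0) then 0 else 1)"
    unfolding total_recursive_def by blast
  have "total_recursive 2 (\<lambda>p xs. g p (xs ! 0) (xs ! 1))"
    using total_recursive_comp1[OF g[unfolded recursive_def], of 2 "\<lambda>p xs. prod_encode (xs ! 0, xs ! 1)"]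
    by (simp add: total_recursive_prod_encode total_recursive_nth)
  then obtain \<Psi> where \<Psi>: "partial_recursive \<Psi>"
    "\<And>p xs. length xs = 2 \<Longrightarrow> \<Psi> p xs = Some (g p (xs ! 0) (xs ! 1))"
    unfolding total_recursive_def by blast
  let ?\<pi> = "\<lambda>p :: baire. \<lambda>xs :: nat list. if 0 < length xs then Some (xs ! 0) else None"
  let ?\<mu> = "\<lambda>p xs. minimize (\<lambda>n. \<Phi> p (n # xs))"
  let ?\<Theta> = "\<lambda>p xs. Option.bind (those (map (\<lambda>g. g p xs) [?\<pi>, ?\<mu>])) (\<Psi> p)"
  have "partial_recursive ?\<Theta>"
    using \<Psi>(1) \<Phi>(1) partial_recursive.search[OF \<Phi>(1)] partial_recursive.proj[of 0]
    by (intro partial_recursive.comp) auto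
  moreover have "?\<Theta> p [n] = Some (g p n (LEAST z. P p n z))" if "\<exists>z. P p n z" for p n
  proof -
    have "least_zero (\<lambda>z. \<Phi> p (z # [n])) (LEAST z. P p n z)"
      unfolding least_zero_def using that \<Phi>(2) by (auto intro: LeastI_ex dest: not_less_Least)
    then have "?\<mu> p [n] = Some (LEAST z. P p n z)" by (simp add: minimize_eq_Some_iff)
    then show ?thesis using \<Psi>(2) by simp
  qed
  ultimately show ?thesis
    unfolding computable_fun_def by (intro exI[of _ ?\<Theta>]) (auto split: if_splits)
qed

section \<open>Comparison of distances with rational numbers\<close>

text \<open>
  Strict inequalities between a distance and a rational number are semidecidable: precision
  \<^term>\<open>m\<close> confirms one if it holds with the error bound subtracted. The threshold is given
  as a fraction (with a difference in the numerator where it may be negative), since its decision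
  is carried out with natural numbers after multiplying out.
\<close>

definition surely_beyond :: "(nat \<Rightarrow> nat \<Rightarrow> nat \<Rightarrow> nat) \<Rightarrow> nat \<Rightarrow> nat \<Rightarrow> nat \<Rightarrow> nat \<Rightarrow> nat \<Rightarrow> bool" where
  "surely_beyond c m i j A C \<longleftrightarrow> real A / real C < rational_of (c i j m) - (1 / 2) ^ m"

definition surely_within :: "(nat \<Rightarrow> nat \<Rightarrow> nat \<Rightarrow> nat) \<Rightarrow> nat \<Rightarrow> nat \<Rightarrow> nat \<Rightarrow> nat \<Rightarrow> nat \<Rightarrow> nat \<Rightarrow> bool" where
  "surely_within c m i j A B C \<longleftrightarrow> rational_of (c i j m) + (1 / 2) ^ m < (real A - real B) / real C"

lemma decidable_surely_beyond:
  assumes c: "computable_nat3 c"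
    and r: "recursive m" "recursive i" "recursive j" "recursive A" "recursive C"
    and pos: "\<And>p x. 0 < C p x"
  shows "decidable (\<lambda>p x. surely_beyond c (m p x) (i p x) (j p x) (A p x) (C p x))"
proof -
  let ?v = "\<lambda>p x. c (i p x) (j p x) (m p x)"
  have eq: "surely_beyond c m i j A C \<longleftrightarrow>
      A * 2 ^ m * Suc (psnd (psnd (c i j m))) + pfst (psnd (c i j m)) * 2 ^ m * C + Suc (psnd (psnd (c i j m))) * C
      < pfst (c i j m) * 2 ^ m * C" if "0 < C" for m i j A C
  proof -
    have real: "a / d < (x - y) / z - 1 / n \<longleftrightarrow> a * n * z + y * n * d + z * d < x * n * d"
      if "d > 0" "z > 0" "n > 0" for a d x y z n :: real
      using that by (simp add: field_simps)
    let ?r = "c i j m"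
    have "surely_beyond c m i j A C \<longleftrightarrow> real A / real C < (real (pfst ?r) - real (pfst (psnd ?r))) / real (Suc (psnd (psnd ?r))) - 1 / 2 ^ m"
      by (simp add: surely_beyond_def rational_of_def case_prod_beta power_one_over)
    also have "\<dots> \<longleftrightarrow> real (A * 2 ^ m * Suc (psnd (psnd ?r)) + pfst (psnd ?r) * 2 ^ m * C + Suc (psnd (psnd ?r)) * C) < real (pfst ?r * 2 ^ m * C)"
      using that by (subst real) (simp_all add: algebra_simps)
    finally show ?thesis unfolding of_nat_less_iff .
  qed
  have v: "recursive ?v" by (intro recursive_nat3[OF c] r)
  have "decidable (\<lambda>p x. A p x * 2 ^ m p x * Suc (psnd (psnd (?v p x))) +
      pfst (psnd (?v p x)) * 2 ^ m p x * C p x + Suc (psnd (psnd (?v p x))) * C p x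
      < pfst (?v p x) * 2 ^ m p x * C p x)"
    by (intro recursive_intros r v)
  then show ?thesis using eq[OF pos] by simp
qed

lemma decidable_surely_within:
  assumes c: "computable_nat3 c"
    and r: "recursive m" "recursive i" "recursive j" "recursive A" "recursive B" "recursive C"
    and pos: "\<And>p x. 0 < C p x"
  shows "decidable (\<lambda>p x. surely_within c (m p x) (i p x) (j p x) (A p x) (B p x) (C p x))"
proof -
  let ?v = "\<lambda>p x. c (i p x) (j p x) (m p x)"
  have eq: "surely_within c m i j A B C \<longleftrightarrow>
      pfst (c i j m) * 2 ^ m * C + Suc (psnd (psnd (c i j m))) * C + B * 2 ^ m * Suc (psnd (psnd (c i j m)))
      < pfst (psnd (c i j m)) * 2 ^ m * C + A * 2 ^ m * Suc (psnd (psnd (c i j m)))"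
    if "0 < C" for m i j A B C
  proof -
    have real: "(x - y) / z + 1 / n < (a - b) / d \<longleftrightarrow>
        x * n * d + z * d + b * n * z < y * n * d + a * n * z"
      if "d > 0" "z > 0" "n > 0" for a b d x y z n :: real
      using that by (simp add: field_simps)
    let ?r = "c i j m"
    have "surely_within c m i j A B C \<longleftrightarrow> (real (pfst ?r) - real (pfst (psnd ?r))) / real (Suc (psnd (psnd ?r))) + 1 / 2 ^ m < (real A - real B) / real C"
      by (simp add: surely_within_def rational_of_def case_prod_beta power_one_over)
    also have "\<dots> \<longleftrightarrow> real (pfst ?r * 2 ^ m * C + Suc (psnd (psnd ?r)) * C + B * 2 ^ m * Suc (psnd (psnd ?r))) < real (pfst (psnd ?r) * 2 ^ m * C + A * 2 ^ m * Suc (psnd (psnd ?r)))"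
      using that by (subst real) (simp_all add: algebra_simps)
    finally show ?thesis unfolding of_nat_less_iff .
  qed
  have v: "recursive ?v" by (intro recursive_nat3[OF c] r)
  have "decidable (\<lambda>p x. pfst (?v p x) * 2 ^ m p x * C p x + Suc (psnd (psnd (?v p x))) * C p x +
      B p x * 2 ^ m p x * Suc (psnd (psnd (?v p x)))
      < pfst (psnd (?v p x)) * 2 ^ m p x * C p x + A p x * 2 ^ m p x * Suc (psnd (psnd (?v p x))))"
    by (intro recursive_intros r v)
  then show ?thesis using eq[OF pos] by simp
qed

definition radius :: "nat \<Rightarrow> real" where
  "radius b = real (Suc (pfst (psnd b))) / real (Suc (psnd (psnd b)))"

lemma rational_ball_radius: "rational_ball \<alpha> b = ball (\<alpha> (pfst b)) (radius b)"
  by (simp add: rational_ball_def radius_def case_prod_beta)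

text \<open>
  The condition on a name bounds the distance of two members; the bound on the
  distance to the limit follows by continuity.
\<close>

lemma cauchy_name_dist:
  assumes "cauchy_name \<alpha> p x"
  shows "dist (\<alpha> (p n)) x \<le> (1 / 2) ^ n"
proof -
  have "(\<lambda>i. dist (\<alpha> (p n)) (\<alpha> (p i))) \<longlonglongrightarrow> dist (\<alpha> (p n)) x"
    using assms unfolding cauchy_name_def by (intro tendsto_intros) auto
  moreover have "dist (\<alpha> (p n)) (\<alpha> (p i)) \<le> (1 / 2) ^ n" if "i \<ge> Suc n" for i
    using assms that unfolding cauchy_name_def by (auto simp: dist_commute)
  ultimately show ?thesis by (intro LIMSEQ_le_const2) auto
qed

locale approximated_metric =
  fixes \<alpha> :: "nat \<Rightarrow> 'a::metric_space" and c :: "nat \<Rightarrow> nat \<Rightarrow> nat \<Rightarrow> nat"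
  assumes dense: "closure (range \<alpha>) = UNIV"
    and computable_dist: "computable_nat3 c"
    and dist_approx: "\<bar>dist (\<alpha> i) (\<alpha> j) - rational_of (c i j n)\<bar> \<le> (1 / 2) ^ n"
begin

lemma approximations_tendsto: "(\<lambda>m. rational_of (c i j m)) \<longlonglongrightarrow> dist (\<alpha> i) (\<alpha> j)"
proof -
  have "\<forall>\<^sub>F m in sequentially. norm (rational_of (c i j m) - dist (\<alpha> i) (\<alpha> j)) \<le> (1 / 2) ^ m"
    unfolding real_norm_def abs_minus_commute[of "rational_of _"] using dist_approx by simp
  then have "(\<lambda>m. rational_of (c i j m) - dist (\<alpha> i) (\<alpha> j)) \<longlonglongrightarrow> 0"
    by (rule Lim_null_comparison) (rule LIMSEQ_power_zero, simp)
  then show ?thesis by (rule LIM_zero_cancel)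
qed

lemma surely_beyondD: "surely_beyond c m i j A C \<Longrightarrow> real A / real C < dist (\<alpha> i) (\<alpha> j)"
  using dist_approx[of i j m] by (simp add: surely_beyond_def)

lemma surely_withinD: "surely_within c m i j A B C \<Longrightarrow> dist (\<alpha> i) (\<alpha> j) < (real A - real B) / real C"
  using dist_approx[of i j m] by (simp add: surely_within_def)

lemma eventually_surely_beyond:
  assumes "real A / real C < dist (\<alpha> i) (\<alpha> j)"
  shows "\<forall>\<^sub>F m in sequentially. surely_beyond c m i j A C"
proof -
  have "(\<lambda>m. rational_of (c i j m) - (1 / 2) ^ m) \<longlonglongrightarrow> dist (\<alpha> i) (\<alpha> j) - 0"
    by (intro tendsto_intros approximations_tendsto LIMSEQ_power_zero) auto
  then show ?thesis unfolding surely_beyond_def using assms by (intro order_tendstoD) auto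
qed

lemma eventually_surely_within:
  assumes "dist (\<alpha> i) (\<alpha> j) < (real A - real B) / real C"
  shows "\<forall>\<^sub>F m in sequentially. surely_within c m i j A B C"
proof -
  have "(\<lambda>m. rational_of (c i j m) + (1 / 2) ^ m) \<longlonglongrightarrow> dist (\<alpha> i) (\<alpha> j) + 0"
    by (intro tendsto_intros approximations_tendsto LIMSEQ_power_zero) auto
  then show ?thesis unfolding surely_within_def using assms by (intro order_tendstoD) auto
qed

section \<open>Compact choice by parallel binary choices\<close>

text \<open>
  A constraint \<open>\<langle>b, \<langle>i, k\<rangle>\<rangle>\<close> says that a point is close to the centre \<^term>\<open>i\<close> if \<open>b = 0\<close>
  and far from it otherwise, on the scale \<open>2\<^sup>-\<^sup>k\<close>. Both alternatives are closed conditions, and every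
  point satisfies at least one of them.
\<close>

definition obeys :: "'a \<Rightarrow> nat \<Rightarrow> bool" where
  "obeys x e \<longleftrightarrow>
     (if pfst e = 0 then dist x (\<alpha> (pfst (psnd e))) \<le> (1 / 2) ^ psnd (psnd e)
      else (1 / 2) ^ psnd (psnd e) \<le> dist x (\<alpha> (pfst (psnd e))))"

definition alive :: "'a set \<Rightarrow> nat \<Rightarrow> bool" where
  "alive K w \<longleftrightarrow> (\<exists>x\<in>K. \<forall>e\<in>set (list_decode w). obeys x e)"

text \<open>
  Formal disjointness of a rational ball with centre \<^term>\<open>a\<close> and radius \<open>\<rho>\<close> from the points that
  obey a constraint: the distance of \<^term>\<open>a\<close> from \<^term>\<open>i\<close> exceeds \<open>2\<^sup>-\<^sup>k + \<rho>\<close>, or it is less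
  than \<open>2\<^sup>-\<^sup>k - \<rho>\<close>, confirmed with precision \<^term>\<open>m\<close>.
\<close>

definition violates :: "nat \<Rightarrow> nat \<Rightarrow> nat \<Rightarrow> bool" where
  "violates m e b \<longleftrightarrow>
     (if pfst e = 0
      then surely_beyond c m (pfst b) (pfst (psnd e))
        (Suc (psnd (psnd b)) + Suc (pfst (psnd b)) * 2 ^ psnd (psnd e)) (Suc (psnd (psnd b)) * 2 ^ psnd (psnd e))
      else surely_within c m (pfst b) (pfst (psnd e))
        (Suc (psnd (psnd b))) (Suc (pfst (psnd b)) * 2 ^ psnd (psnd e)) (Suc (psnd (psnd b)) * 2 ^ psnd (psnd e)))"

text \<open>
  A stage combines the number of a cover in the name with a precision. A refutation is sound because
  the balls of the cover exhaust the compact set.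
\<close>

definition refuted :: "baire \<Rightarrow> nat \<Rightarrow> nat \<Rightarrow> bool" where
  "refuted p w s \<longleftrightarrow>
     (\<forall>b\<in>set (list_decode (p (pfst s))). \<exists>e\<in>set (list_decode w). violates (psnd s) e b)"

lemma radius_threshold:
  "real (Suc (psnd (psnd b)) + Suc (pfst (psnd b)) * 2 ^ k) / real (Suc (psnd (psnd b)) * 2 ^ k)
     = (1 / 2) ^ k + radius b"
  "(real (Suc (psnd (psnd b))) - real (Suc (pfst (psnd b)) * 2 ^ k)) / real (Suc (psnd (psnd b)) * 2 ^ k)
     = (1 / 2) ^ k - radius b"
proof -
  have "(r + s * m) / (r * m) = 1 / m + s / r" "(r - s * m) / (r * m) = 1 / m - s / r"
    if "r > 0" "m > 0" for r s m :: real
    using that by (simp_all add: field_simps)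
  from this[of "real (Suc (psnd (psnd b)))" "2 ^ k" "real (Suc (pfst (psnd b)))"]
  show "real (Suc (psnd (psnd b)) + Suc (pfst (psnd b)) * 2 ^ k) / real (Suc (psnd (psnd b)) * 2 ^ k)
      = (1 / 2) ^ k + radius b"
    "(real (Suc (psnd (psnd b))) - real (Suc (pfst (psnd b)) * 2 ^ k)) / real (Suc (psnd (psnd b)) * 2 ^ k)
      = (1 / 2) ^ k - radius b"
    by (simp_all add: radius_def power_one_over del: of_nat_Suc mult_Suc add_Suc)
qed

lemma violates_sound:
  assumes "violates m e b" "x \<in> rational_ball \<alpha> b"
  shows "\<not> obeys x e"
proof -
  let ?i = "pfst (psnd e)" and ?a = "pfst b"
  have x: "dist (\<alpha> ?a) x < radius b" using assms(2) by (simp add: rational_ball_radius)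
  show ?thesis
  proof (cases "pfst e = 0")
    case True
    then have "(1 / 2) ^ psnd (psnd e) + radius b < dist (\<alpha> ?a) (\<alpha> ?i)"
      using assms(1) unfolding radius_threshold(1)[symmetric] violates_def
      by (simp only: simp_thms if_True surely_beyondD)
    then show ?thesis
      using x dist_triangle[of "\<alpha> ?a" "\<alpha> ?i" x] True by (simp add: obeys_def)
  next
    case False
    then have "dist (\<alpha> ?a) (\<alpha> ?i) < (1 / 2) ^ psnd (psnd e) - radius b"
      using assms(1) unfolding radius_threshold(2)[symmetric] violates_def
      by (simp only: if_False surely_withinD)
    then show ?thesis
      using x dist_triangle[of x "\<alpha> ?i" "\<alpha> ?a"] False by (simp add: obeys_def dist_commute)
  qed
qed

text \<open>
  A point that breaks a constraint breaks it by a positive margin; a ball of less than half that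
  margin around the point is formally disjoint from the constraint.
\<close>

lemma violates_complete:
  assumes "\<not> obeys x e"
  shows "\<exists>b. x \<in> rational_ball \<alpha> b \<and> (\<forall>\<^sub>F m in sequentially. violates m e b)"
proof -
  let ?i = "pfst (psnd e)" and ?k = "psnd (psnd e)"
  define \<delta> where "\<delta> = \<bar>dist x (\<alpha> ?i) - (1 / 2) ^ ?k\<bar>"
  have "\<delta> > 0" using assms by (auto simp: \<delta>_def obeys_def split: if_splits)
  then obtain q where q: "1 / real (Suc q) < \<delta> / 2"
    using nat_approx_posE[of "\<delta> / 2"] by auto
  obtain a where a: "dist (\<alpha> a) x < 1 / real (Suc q)"
    using dense_point[OF dense, of "1 / real (Suc q)" x] by auto
  define b where "b = prod_encode (a, prod_encode (0, q))"
  have r: "radius b = 1 / real (Suc q)" "pfst b = a" by (simp_all add: b_def radius_def)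
  have "\<forall>\<^sub>F m in sequentially. violates m e b"
  proof (cases "pfst e = 0")
    case True
    then have "(1 / 2) ^ ?k + radius b < dist (\<alpha> a) (\<alpha> ?i)"
      using assms q a r dist_triangle[of x "\<alpha> ?i" "\<alpha> a"]
      by (simp add: obeys_def \<delta>_def dist_commute)
    then show ?thesis
      using True unfolding radius_threshold(1)[symmetric] violates_def r(2)
      by (simp only: simp_thms if_True eventually_surely_beyond)
  next
    case False
    then have "dist (\<alpha> a) (\<alpha> ?i) < (1 / 2) ^ ?k - radius b"
      using assms q a r dist_triangle[of "\<alpha> a" "\<alpha> ?i" x]
      by (simp add: obeys_def \<delta>_def dist_commute)
    then show ?thesis
      using False unfolding radius_threshold(2)[symmetric] violates_def r(2)
      by (simp only: if_False eventually_surely_within)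
  qed
  moreover have "x \<in> rational_ball \<alpha> b" using a r by (simp add: rational_ball_radius)
  ultimately show ?thesis by blast
qed

lemma refuted_sound:
  assumes "compact_name \<alpha> p K" "refuted p w s"
  shows "\<not> alive K w"
proof
  assume "alive K w"
  then obtain x where x: "x \<in> K" "\<forall>e\<in>set (list_decode w). obeys x e" unfolding alive_def by blast
  have "K \<subseteq> family_union \<alpha> (p (pfst s))" using assms(1) unfolding compact_name_def by blast
  then obtain b where "b \<in> set (list_decode (p (pfst s)))" "x \<in> rational_ball \<alpha> b"
    using x(1) unfolding family_union_def by blast
  then show False using assms(2) violates_sound x(2) unfolding refuted_def by blast
qed

text \<open>
  If no point of the compact set satisfies all the constraints, then the balls that formally violate
  one of them cover the set. A finite subcover occurs in the name, and one precision serves for its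
  finitely many balls.
\<close>

lemma refuted_complete:
  assumes p: "compact_name \<alpha> p K" and w: "\<not> alive K w"
  shows "\<exists>s. refuted p w s"
proof -
  have K: "compact K" using p by (simp add: compact_name_def)
  have "\<forall>x\<in>K. \<exists>b. x \<in> rational_ball \<alpha> b \<and>
      (\<forall>\<^sub>F m in sequentially. \<exists>e\<in>set (list_decode w). violates m e b)"
  proof
    fix x assume "x \<in> K"
    then obtain e where e: "e \<in> set (list_decode w)" "\<not> obeys x e"
      using w unfolding alive_def by blast
    obtain b where b: "x \<in> rational_ball \<alpha> b" "\<forall>\<^sub>F m in sequentially. violates m e b"
      using violates_complete[OF e(2)] by blast
    have "\<forall>\<^sub>F m in sequentially. \<exists>e\<in>set (list_decode w). violates m e b"
      using b(2) by (rule eventually_mono) (use e(1) in blast)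
    then show "\<exists>b. x \<in> rational_ball \<alpha> b \<and>
      (\<forall>\<^sub>F m in sequentially. \<exists>e\<in>set (list_decode w). violates m e b)" using b(1) by blast
  qed
  from bchoice[OF this] obtain b where b: "\<forall>x\<in>K. x \<in> rational_ball \<alpha> (b x) \<and>
      (\<forall>\<^sub>F m in sequentially. \<exists>e\<in>set (list_decode w). violates m e (b x))" by blast
  have "K \<subseteq> (\<Union>x\<in>K. rational_ball \<alpha> (b x))" using b by blast
  then obtain C where C: "C \<subseteq> K" "finite C" "K \<subseteq> (\<Union>x\<in>C. rational_ball \<alpha> (b x))"
    using compactE_image[OF K, of K "\<lambda>x. rational_ball \<alpha> (b x)"]
    by (metis open_ball rational_ball_radius)
  obtain bs where bs: "set bs = b ` C" using C(2) finite_list[of "b ` C"] by auto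
  have "K \<subseteq> family_union \<alpha> (list_encode bs)" using C(3) by (simp add: family_union_def bs)
  then obtain u where u: "p u = list_encode bs"
    using p unfolding compact_name_def by (metis (mono_tags, lifting) mem_Collect_eq rangeE)
  have "\<forall>\<^sub>F m in sequentially. \<forall>d\<in>b ` C. \<exists>e\<in>set (list_decode w). violates m e d"
    using C(1,2) b by (intro eventually_ball_finite) auto
  then obtain m where "\<forall>d\<in>b ` C. \<exists>e\<in>set (list_decode w). violates m e d"
    using eventually_happens'[OF sequentially_bot] by blast
  then have "refuted p w (prod_encode (u, m))" by (simp add: refuted_def u bs)
  then show ?thesis ..
qed

text \<open>
  Each answer is stored together with its question, so that a list of constraints has a meaning
  without reference to positions.
\<close>

definition extend :: "nat \<Rightarrow> nat \<Rightarrow> nat \<Rightarrow> nat" where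
  "extend b t w = Suc (prod_encode (prod_encode (b, t), w))"

lemma list_decode_extend [simp]: "list_decode (extend b t w) = prod_encode (b, t) # list_decode w"
  by (simp add: extend_def)

lemma alive_extend: "alive K w \<Longrightarrow> alive K (extend 0 t w) \<or> alive K (extend (Suc b) t w)"
proof -
  assume "alive K w"
  then obtain x where x: "x \<in> K" "\<forall>e\<in>set (list_decode w). obeys x e" unfolding alive_def by blast
  have "obeys x (prod_encode (0, t)) \<or> obeys x (prod_encode (Suc b, t))"
    using linear by (auto simp: obeys_def)
  then show ?thesis using x by (auto simp: alive_def)
qed

text \<open>
  The instance of LLPO with index \<open>\<langle>t, w\<rangle>\<close> asks which of the two answers to question \<^term>\<open>t\<close> may be
  added to the constraints \<^term>\<open>w\<close>. Position \<open>2 * s + b\<close> examines whether stage \<^term>\<open>s\<close> refutes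
  the extension by answer \<^term>\<open>b\<close>, and only the first success is recorded. All lists are asked in
  advance, so the questions do not depend on the answers.
\<close>

definition hit :: "baire \<Rightarrow> nat \<Rightarrow> nat \<Rightarrow> bool" where
  "hit p v j \<longleftrightarrow> refuted p (extend (j mod 2) (pfst v) (psnd v)) (j div 2)"

definition questions :: "baire \<Rightarrow> baire" where
  "questions p x = (if hit p (pfst x) (psnd x) \<and> (\<forall>j<psnd x. \<not> hit p (pfst x) j) then 1 else 0)"

lemma component_questions:
  "component (questions p) v j = (if hit p v j \<and> (\<forall>i<j. \<not> hit p v i) then 1 else 0)"
  by (simp add: component_def questions_def)

lemma LLPO_questions:
  "0 \<in> LLPO (component (questions p) v) \<or> 1 \<in> LLPO (component (questions p) v)"
proof -
  let ?q = "component (questions p) v"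
  have one: "\<forall>k l. ?q k \<noteq> 0 \<and> ?q l \<noteq> 0 \<longrightarrow> k = l"
    unfolding component_questions by (metis linorder_neqE_nat)
  have "(\<forall>n. ?q (2 * n) = 0) \<or> (\<forall>n. ?q (2 * n + 1) = 0)"
  proof (rule ccontr)
    assume "\<not> ?thesis"
    then obtain n n' where "?q (2 * n) \<noteq> 0" "?q (2 * n' + 1) \<noteq> 0" by metis
    then have "2 * n = 2 * n' + 1" using one by blast
    then show False by presburger
  qed
  then show ?thesis unfolding LLPO_def if_P[OF one] by blast
qed

lemma questions_in_mdom: "questions p \<in> mdom LLPO_hat"
proof -
  have "\<forall>k. \<exists>i. i \<in> LLPO (component (questions p) k)" using LLPO_questions by blast
  then obtain q where "\<forall>k. q k \<in> LLPO (component (questions p) k)" by metis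
  then show ?thesis unfolding mdom_def LLPO_hat_def by blast
qed

text \<open>
  One of the two extensions is alive and is never refuted. If the other one is dead, then it is
  refuted at some stage, the first success lies on its side, and LLPO cannot answer with it.
\<close>

lemma answer_alive:
  assumes p: "compact_name \<alpha> p K" and w: "alive K w"
    and a: "a \<in> LLPO (component (questions p) (prod_encode (t, w)))"
  shows "alive K (extend a t w)"
proof (rule ccontr)
  let ?v = "prod_encode (t, w)"
  assume dead: "\<not> alive K (extend a t w)"
  have a01: "a = 0 \<or> a = 1" using a unfolding LLPO_def by (auto split: if_splits)
  have zero: "component (questions p) ?v j = 0" if "j mod 2 = a" for j
  proof -
    have "j = 2 * (j div 2) + a" using that by (metis mult_div_mod_eq)
    then show ?thesis using a unfolding LLPO_def by (auto split: if_splits) metis+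
  qed
  have sibling: "alive K (extend b t w)" if "b < 2" "b \<noteq> a" for b
    using alive_extend[OF w, of t 0] dead that a01 by (auto simp: less_2_cases_iff)
  obtain s where "refuted p (extend a t w) s" using refuted_complete[OF p dead] by blast
  then have "hit p ?v (2 * s + a)" using a01 by (auto simp: hit_def)
  then obtain j where j: "hit p ?v j" "\<forall>i<j. \<not> hit p ?v i"
    using exists_least_iff[of "hit p ?v"] by blast
  then have "j mod 2 \<noteq> a" using zero[of j] by (auto simp: component_questions)
  then show False using j(1) refuted_sound[OF p] sibling[of "j mod 2"] by (auto simp: hit_def)
qed

definition path :: "baire \<Rightarrow> nat \<Rightarrow> nat" where
  "path r n = rec_nat 0 (\<lambda>t w. extend (r (prod_encode (t, w))) t w) n"

definition answer :: "baire \<Rightarrow> nat \<Rightarrow> nat" where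
  "answer r t = r (prod_encode (t, path r t))"

lemma path_simps: "path r 0 = 0" "path r (Suc t) = extend (answer r t) t (path r t)"
  by (simp_all add: path_def answer_def)

lemma set_path: "set (list_decode (path r n)) = (\<lambda>t. prod_encode (answer r t, t)) ` {..<n}"
  by (induction n) (auto simp: path_simps lessThan_Suc)

lemma path_alive:
  assumes p: "compact_name \<alpha> p K" and "K \<noteq> {}" and r: "r \<in> LLPO_hat (questions p)"
  shows "alive K (path r n)"
proof (induction n)
  case 0
  show ?case using \<open>K \<noteq> {}\<close> by (auto simp: alive_def path_simps)
next
  case (Suc n)
  have "answer r n \<in> LLPO (component (questions p) (prod_encode (n, path r n)))"
    using r by (simp add: LLPO_hat_def answer_def)
  then show ?case using answer_alive[OF p Suc] by (simp add: path_simps)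
qed

text \<open>
  The constraints on the path are closed and finitely many of them are always met by a common point,
  so compactness yields one point that meets all.
\<close>

lemma path_point:
  assumes p: "compact_name \<alpha> p K" and ne: "K \<noteq> {}" and r: "r \<in> LLPO_hat (questions p)"
  shows "\<exists>x\<in>K. \<forall>t. obeys x (prod_encode (answer r t, t))"
proof -
  let ?F = "\<lambda>t. {x. obeys x (prod_encode (answer r t, t))}"
  have K: "compact K" using p by (simp add: compact_name_def)
  have "closed (?F t)" for t
    unfolding obeys_def
    by (cases "pfst (prod_encode (answer r t, t)) = 0")
      (simp_all add: closed_Collect_le continuous_on_dist)
  moreover have "K \<inter> (\<Inter>t\<in>I. ?F t) \<noteq> {}" if I: "finite I" for I
  proof -
    obtain n where "I \<subseteq> {..<n}" using finite_nat_bounded[OF I] by blast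
    moreover obtain x where "x \<in> K" "\<forall>t<n. obeys x (prod_encode (answer r t, t))"
      using path_alive[OF p ne r, of n] unfolding alive_def set_path by auto
    ultimately have "x \<in> K \<inter> (\<Inter>t\<in>I. ?F t)" by auto
    then show ?thesis by blast
  qed
  ultimately have "K \<inter> (\<Inter>t\<in>UNIV. ?F t) \<noteq> {}"
    by (rule compact_imp_fip_image[OF K])
  then show ?thesis by blast
qed

definition centre_found :: "baire \<Rightarrow> nat \<Rightarrow> nat \<Rightarrow> bool" where
  "centre_found r n i \<longleftrightarrow> answer r (prod_encode (i, Suc n)) = 0"

text \<open>
  A centre at distance less than \<open>2\<^sup>-\<^sup>n\<^sup>-\<^sup>1\<close> from the point cannot have been declared far, hence the
  search for a centre declared close succeeds. The exponent is shifted by one so that the centres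
  found for \<^term>\<open>n\<close> and for any larger number have distance at most \<open>2\<^sup>-\<^sup>n\<close>. The name of the compact
  set is not consulted, as strong reducibility demands.
\<close>

lemma centres_cauchy_name:
  assumes x: "\<And>t. obeys x (prod_encode (answer r t, t))"
  shows "\<forall>n. \<exists>i. centre_found r n i" "cauchy_name \<alpha> (\<lambda>n. LEAST i. centre_found r n i) x"
proof -
  show ex: "\<forall>n. \<exists>i. centre_found r n i"
  proof
    fix n
    obtain i where "dist (\<alpha> i) x < (1 / 2) ^ Suc n"
      using dense_point[OF dense, of "(1 / 2) ^ Suc n" x] by auto
    then have "centre_found r n i"
      using x[of "prod_encode (i, Suc n)"]
      by (auto simp: obeys_def centre_found_def dist_commute split: if_splits)
    then show "\<exists>i. centre_found r n i" ..
  qed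
  define q where "q n = (LEAST i. centre_found r n i)" for n
  have q: "dist x (\<alpha> (q n)) \<le> (1 / 2) ^ Suc n" for n
  proof -
    have "centre_found r n (q n)" unfolding q_def by (rule LeastI_ex[OF spec[OF ex]])
    then show ?thesis
      using x[of "prod_encode (q n, Suc n)"] by (simp add: obeys_def centre_found_def)
  qed
  have "dist (\<alpha> (q i)) (\<alpha> (q j)) \<le> (1 / 2) ^ j" if "j < i" for i j
  proof -
    have "(1 / 2 :: real) ^ Suc i \<le> (1 / 2) ^ Suc j"
      using that by (intro power_decreasing) auto
    then have "dist x (\<alpha> (q i)) + dist x (\<alpha> (q j)) \<le> (1 / 2) ^ Suc j + (1 / 2) ^ Suc j"
      using q[of i] q[of j] by linarith
    then have "dist x (\<alpha> (q i)) + dist x (\<alpha> (q j)) \<le> (1 / 2) ^ j" by simp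
    then show ?thesis using dist_triangle3[of "\<alpha> (q i)" "\<alpha> (q j)" x] by simp
  qed
  moreover have "(\<lambda>i. \<alpha> (q i)) \<longlonglongrightarrow> x"
  proof -
    have "(\<lambda>i. (1 / 2 :: real) ^ Suc i) \<longlonglongrightarrow> 0"
      by (intro LIMSEQ_Suc LIMSEQ_power_zero) simp
    then have "(\<lambda>i. dist (\<alpha> (q i)) x) \<longlonglongrightarrow> 0"
      by (rule Lim_null_comparison[rotated]) (use q in \<open>auto simp: dist_commute intro!: always_eventually\<close>)
    then show ?thesis by (subst tendsto_dist_iff)
  qed
  ultimately show "cauchy_name \<alpha> (\<lambda>n. LEAST i. centre_found r n i) x"
    unfolding cauchy_name_def q_def by blast
qed

lemma decidable_violates [recursive_intros]:
  assumes "recursive m" "recursive e" "recursive b"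
  shows "decidable (\<lambda>p x. violates (m p x) (e p x) (b p x))"
  unfolding violates_def if_bool_eq_disj
  by (intro recursive_intros decidable_surely_beyond decidable_surely_within computable_dist assms) simp_all

lemma decidable_hit [recursive_intros]:
  assumes "recursive v" "recursive j"
  shows "decidable (\<lambda>p x. hit p (v p x) (j p x))"
proof -
  have "decidable (\<lambda>p x. hit p (pfst x) (psnd x))"
    unfolding hit_def refuted_def extend_def by (intro recursive_intros)
  then show ?thesis using assms by (rule decidable_comp_pair)
qed

lemma recursive_questions: "recursive questions"
  unfolding questions_def by (intro recursive_intros)

lemma decidable_centre_found: "decidable (\<lambda>r y. centre_found r (pfst y) (psnd y))"
  unfolding centre_found_def answer_def path_def extend_def by (intro recursive_intros)

theorem compact_choice_le_LLPO_hat: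
  "sW_reducible (compact_rep \<alpha>) (cauchy_rep \<alpha>) compact_choice baire_rep baire_rep LLPO_hat"
proof -
  let ?K = "\<lambda>p. Some (questions p)"
  let ?H = "\<lambda>r. if \<forall>n. \<exists>i. centre_found r n i then Some (\<lambda>n. LEAST i. centre_found r n i) else None"
  have "computable_fun ?K" by (rule computable_fun_total[OF recursive_questions])
  moreover have "computable_fun ?H"
    by (rule computable_fun_search[OF decidable_centre_found, of "\<lambda>r n i. i"]) (intro recursive_intros)
  moreover have "realizer (compact_rep \<alpha>) (cauchy_rep \<alpha>) compact_choice (?H \<circ>\<^sub>m G \<circ>\<^sub>m ?K)"
    if G: "realizer baire_rep baire_rep LLPO_hat G" for G
    unfolding realizer_def
  proof (intro allI impI)
    fix p K assume "compact_rep \<alpha> p = Some K \<and> K \<in> mdom compact_choice"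
    then have p: "compact_name \<alpha> p K" and ne: "K \<noteq> {}" and K: "compact_choice K = K"
      by (auto simp: compact_rep_eq_Some_iff[OF dense] mdom_def compact_choice_def split: if_splits)
    obtain r where r: "G (questions p) = Some r" "r \<in> LLPO_hat (questions p)"
      using G questions_in_mdom unfolding realizer_def baire_rep_def by blast
    obtain x where x: "x \<in> K" "\<And>t. obeys x (prod_encode (answer r t, t))"
      using path_point[OF p ne r(2)] by blast
    note name = centres_cauchy_name[OF x(2)]
    show "\<exists>q y. (?H \<circ>\<^sub>m G \<circ>\<^sub>m ?K) p = Some q \<and> cauchy_rep \<alpha> q = Some y \<and> y \<in> compact_choice K"
      using x(1) K r(1) name by (auto simp: map_comp_def cauchy_rep_eq_Some_iff)
  qed
  ultimately show ?thesis unfolding sW_reducible_def by blast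
qed

end

section \<open>Finite stages of computations with an oracle\<close>

text \<open>
  A natural number serves as a finite binary oracle, namely the sequence of its binary digits.
\<close>

definition agrees :: "nat \<Rightarrow> nat \<Rightarrow> baire \<Rightarrow> bool" where
  "agrees w s p \<longleftrightarrow> (\<forall>i<s. digit w i = p i)"

text \<open>
  A stage of a computation returns \<^term>\<open>Suc v\<close> if the first \<^term>\<open>s\<close> digits of \<^term>\<open>w\<close> already force
  the result \<^term>\<open>v\<close> for every oracle that extends them, and \<open>0\<close> if no result is available yet.
  Completeness is required for all large
  \<^term>\<open>s\<close>, so that finitely many computations can be combined at a common stage.
\<close>

definition simulates :: "(nat \<Rightarrow> nat \<Rightarrow> nat list \<Rightarrow> nat) \<Rightarrow> (baire \<Rightarrow> nat list \<rightharpoonup> nat) \<Rightarrow> bool" where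
  "simulates \<phi> \<Phi> \<longleftrightarrow>
     (\<forall>w s xs v p. \<phi> w s xs = Suc v \<longrightarrow> agrees w s p \<longrightarrow> \<Phi> p xs = Some v) \<and>
     (\<forall>p xs v. \<Phi> p xs = Some v \<longrightarrow> (\<forall>\<^sub>F s in sequentially. \<forall>w. agrees w s p \<longrightarrow> \<phi> w s xs = Suc v))"

text \<open>
  Argument lists are passed by their codes, because functionals accept lists of every length.
\<close>

definition recursive_stage :: "(nat \<Rightarrow> nat \<Rightarrow> nat list \<Rightarrow> nat) \<Rightarrow> bool" where
  "recursive_stage \<phi> \<longleftrightarrow> recursive (\<lambda>p x. \<phi> (pfst x) (pfst (psnd x)) (list_decode (psnd (psnd x))))"

lemma simulatesI:
  assumes "\<And>w s xs v p. \<phi> w s xs = Suc v \<Longrightarrow> agrees w s p \<Longrightarrow> \<Phi> p xs = Some v"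
    and "\<And>p xs v. \<Phi> p xs = Some v \<Longrightarrow> \<forall>\<^sub>F s in sequentially. \<forall>w. agrees w s p \<longrightarrow> \<phi> w s xs = Suc v"
  shows "simulates \<phi> \<Phi>"
  using assms unfolding simulates_def by blast

lemma simulates_sound: "simulates \<phi> \<Phi> \<Longrightarrow> \<phi> w s xs = Suc v \<Longrightarrow> agrees w s p \<Longrightarrow> \<Phi> p xs = Some v"
  unfolding simulates_def by blast

lemma simulates_complete:
  "simulates \<phi> \<Phi> \<Longrightarrow> \<Phi> p xs = Some v \<Longrightarrow> \<forall>\<^sub>F s in sequentially. \<forall>w. agrees w s p \<longrightarrow> \<phi> w s xs = Suc v"
  unfolding simulates_def by blast

lemma recursive_stageD:
  assumes "recursive_stage \<phi>" "recursive w" "recursive s" "recursive c"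
  shows "recursive (\<lambda>p x. \<phi> (w p x) (s p x) (list_decode (c p x)))"
  using recursive_comp[OF assms(1)[unfolded recursive_stage_def], of "\<lambda>p x. prod_encode (w p x, prod_encode (s p x, c p x))"]
    assms(2-) by (simp add: recursive_intros)

lemma case_list_decode:
  "(case list_decode c of [] \<Rightarrow> a | x # ys \<Rightarrow> f x ys)
     = (if c = 0 then a else f (pfst (c - 1)) (list_decode (psnd (c - 1))))"
  by (cases c) (auto split: prod.split)

lemma nth_list_decode:
  "(if i < length (list_decode c) then Suc (list_decode c ! i) else 0)
     = (if tail_code c i = 0 then 0 else Suc (pfst (tail_code c i - 1)))"
  using pfst_tail_code[of i c] by (auto simp: tail_code_eq_0_iff)

lemma simulation_zero: "simulates (\<lambda>w s xs. 1) (\<lambda>p xs. Some 0)"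
  by (rule simulatesI) auto

lemma simulation_succ:
  "simulates (\<lambda>w s xs. case xs of [] \<Rightarrow> 0 | x # _ \<Rightarrow> Suc (Suc x))
     (\<lambda>p xs. case xs of [] \<Rightarrow> None | x # _ \<Rightarrow> Some (Suc x))"
  by (rule simulatesI) (auto split: list.splits)

lemma simulation_proj:
  "simulates (\<lambda>w s xs. if i < length xs then Suc (xs ! i) else 0)
     (\<lambda>p xs. if i < length xs then Some (xs ! i) else None)"
  by (rule simulatesI) (auto split: if_splits)

lemma simulation_query:
  "simulates (\<lambda>w s xs. case xs of [] \<Rightarrow> 0 | x # _ \<Rightarrow> if x < s then Suc (digit w x) else 0)
     (\<lambda>p xs. case xs of [] \<Rightarrow> None | x # _ \<Rightarrow> Some (p x))"
proof (rule simulatesI)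
  fix p :: baire and xs v assume "(case xs of [] \<Rightarrow> None | x # _ \<Rightarrow> Some (p x)) = Some v"
  then obtain x ys where xs: "xs = x # ys" "p x = v" by (auto split: list.splits)
  have "\<forall>\<^sub>F s in sequentially. x < s" by (rule eventually_gt_at_top)
  then show "\<forall>\<^sub>F s in sequentially. \<forall>w. agrees w s p \<longrightarrow>
      (case xs of [] \<Rightarrow> 0 | x # _ \<Rightarrow> if x < s then Suc (digit w x) else 0) = Suc v"
    by (rule eventually_mono) (simp add: agrees_def xs)
qed (auto simp: agrees_def split: list.splits if_splits)

lemma those_eq_Some_iff: "those zs = Some ys \<longleftrightarrow> zs = map Some ys"
proof (induction zs arbitrary: ys)
  case (Cons z zs)
  then show ?case by (cases z) (auto simp: Cons_eq_map_conv)
qed auto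

definition comp_stage where
  "comp_stage \<phi> gs \<sigma> w s xs =
     (if \<exists>g\<in>set gs. \<sigma> g w s xs = 0 then 0 else \<phi> w s (map (\<lambda>g. \<sigma> g w s xs - 1) gs))"

lemma simulation_comp:
  assumes \<phi>: "simulates \<phi> f" and \<sigma>: "\<And>g. g \<in> set gs \<Longrightarrow> simulates (\<sigma> g) g"
  shows "simulates (comp_stage \<phi> gs \<sigma>) (\<lambda>p xs. Option.bind (those (map (\<lambda>g. g p xs) gs)) (f p))"
proof (rule simulatesI)
  fix w s xs v p assume v: "comp_stage \<phi> gs \<sigma> w s xs = Suc v" and w: "agrees w s p"
  then have nz: "\<forall>g\<in>set gs. \<sigma> g w s xs \<noteq> 0" and f: "\<phi> w s (map (\<lambda>g. \<sigma> g w s xs - 1) gs) = Suc v"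
    by (auto simp: comp_stage_def split: if_splits)
  have "g p xs = Some (\<sigma> g w s xs - 1)" if "g \<in> set gs" for g
    using simulates_sound[OF \<sigma>[OF that], OF _ w] nz that by simp
  then have "those (map (\<lambda>g. g p xs) gs) = Some (map (\<lambda>g. \<sigma> g w s xs - 1) gs)"
    by (rule those_map_Some)
  then show "Option.bind (those (map (\<lambda>g. g p xs) gs)) (f p) = Some v"
    using simulates_sound[OF \<phi>, OF f w] by simp
next
  fix p xs v assume "Option.bind (those (map (\<lambda>g. g p xs) gs)) (f p) = Some v"
  then obtain ys where ys: "those (map (\<lambda>g. g p xs) gs) = Some ys" and f: "f p ys = Some v"
    by (auto simp: bind_eq_Some_conv)
  have map: "map (\<lambda>g. g p xs) gs = map Some ys" using ys by (simp only: those_eq_Some_iff)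
  have defined: "g p xs = Some (the (g p xs))" if "g \<in> set gs" for g
  proof -
    have "g p xs \<in> set (map (\<lambda>g. g p xs) gs)" using that by simp
    then show ?thesis unfolding map by auto
  qed
  have ys': "ys = map (\<lambda>g. the (g p xs)) gs"
    using arg_cong[OF map, of "map the"] by (simp add: o_def)
  have "\<forall>\<^sub>F s in sequentially. \<forall>g\<in>set gs. \<forall>w. agrees w s p \<longrightarrow> \<sigma> g w s xs = Suc (the (g p xs))"
    by (intro eventually_ball_finite ballI simulates_complete[OF \<sigma>] defined) simp_all
  moreover have "\<forall>\<^sub>F s in sequentially. \<forall>w. agrees w s p \<longrightarrow> \<phi> w s ys = Suc v"
    by (rule simulates_complete[OF \<phi>, OF f])
  ultimately show "\<forall>\<^sub>F s in sequentially. \<forall>w. agrees w s p \<longrightarrow> comp_stage \<phi> gs \<sigma> w s xs = Suc v"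
  proof eventually_elim
    case (elim s)
    show ?case
    proof (intro allI impI)
      fix w assume w: "agrees w s p"
      then have \<sigma>: "\<sigma> g w s xs = Suc (the (g p xs))" if "g \<in> set gs" for g using elim(1) that by blast
      then have "map (\<lambda>g. \<sigma> g w s xs - 1) gs = ys" unfolding ys' by simp
      then show "comp_stage \<phi> gs \<sigma> w s xs = Suc v" using elim(2) w \<sigma> by (simp add: comp_stage_def)
    qed
  qed
qed

definition prim_rec_stage where
  "prim_rec_stage \<phi> \<gamma> w s xs = (case xs of [] \<Rightarrow> 0
     | n # ys \<Rightarrow> rec_nat (\<phi> w s ys) (\<lambda>k r. if r = 0 then 0 else \<gamma> w s (k # (r - 1) # ys)) n)"

lemma simulation_prim_rec:
  assumes \<phi>: "simulates \<phi> f" and \<gamma>: "simulates \<gamma> g"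
  shows "simulates (prim_rec_stage \<phi> \<gamma>) (\<lambda>p xs. case xs of [] \<Rightarrow> None
      | n # ys \<Rightarrow> rec_nat (f p ys) (\<lambda>k r. Option.bind r (\<lambda>v. g p (k # v # ys))) n)"
proof (rule simulatesI)
  fix w s xs v p assume v: "prim_rec_stage \<phi> \<gamma> w s xs = Suc v" and w: "agrees w s p"
  obtain n ys where xs: "xs = n # ys" using v by (auto simp: prim_rec_stage_def split: list.splits)
  have "rec_nat (f p ys) (\<lambda>k r. Option.bind r (\<lambda>v. g p (k # v # ys))) n = Some v"
    using v unfolding prim_rec_stage_def xs list.case
  proof (induction n arbitrary: v)
    case (Suc n)
    let ?r = "rec_nat (\<phi> w s ys) (\<lambda>k r. if r = 0 then 0 else \<gamma> w s (k # (r - 1) # ys)) n"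
    have r: "?r = Suc (?r - 1)" and "\<gamma> w s (n # (?r - 1) # ys) = Suc v"
      using Suc.prems by (auto split: if_splits)
    then show ?case using Suc.IH[OF r] simulates_sound[OF \<gamma>, OF _ w] by simp
  qed (use simulates_sound[OF \<phi>, OF _ w] in simp)
  then show "(case xs of [] \<Rightarrow> None
      | n # ys \<Rightarrow> rec_nat (f p ys) (\<lambda>k r. Option.bind r (\<lambda>v. g p (k # v # ys))) n) = Some v"
    by (simp add: xs)
next
  fix p xs v assume v: "(case xs of [] \<Rightarrow> None
      | n # ys \<Rightarrow> rec_nat (f p ys) (\<lambda>k r. Option.bind r (\<lambda>v. g p (k # v # ys))) n) = Some v"
  obtain n ys where xs: "xs = n # ys" using v by (auto split: list.splits)
  show "\<forall>\<^sub>F s in sequentially. \<forall>w. agrees w s p \<longrightarrow> prim_rec_stage \<phi> \<gamma> w s xs = Suc v"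
    using v unfolding prim_rec_stage_def xs list.case
  proof (induction n arbitrary: v)
    case 0
    then show ?case using simulates_complete[OF \<phi>] by simp
  next
    case (Suc n)
    let ?R = "rec_nat (f p ys) (\<lambda>k r. Option.bind r (\<lambda>v. g p (k # v # ys))) n"
    obtain u where u: "?R = Some u" "g p (n # u # ys) = Some v"
      using Suc.prems unfolding nat.rec bind_eq_Some_conv by (elim exE conjE)
    from eventually_conj[OF Suc.IH[OF u(1)] simulates_complete[OF \<gamma>, OF u(2)]] show ?case
      by (rule eventually_mono) simp
  qed
qed

text \<open>
  The first number below the bound at which the predicate fails, and the bound itself if there is
  none.
\<close>

definition scan :: "(nat \<Rightarrow> bool) \<Rightarrow> nat \<Rightarrow> nat" where
  "scan P s = rec_nat 0 (\<lambda>n r. if r = n \<and> P n then Suc n else r) s"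

lemma scan: "(\<forall>j<scan P s. P j) \<and> scan P s \<le> s \<and> (scan P s < s \<longrightarrow> \<not> P (scan P s))"
  by (induction s) (auto simp: scan_def less_Suc_eq)

text \<open>
  The scan stops at the first argument whose value at this stage is zero or not yet available; only
  in the former case is the search known to have succeeded.
\<close>

definition search_stage where
  "search_stage \<phi> w s xs =
     (let n = scan (\<lambda>n. 1 < \<phi> w s (n # xs)) s
      in if n < s \<and> \<phi> w s (n # xs) = (1::nat) then Suc n else 0)"

lemma simulation_search:
  assumes \<phi>: "simulates \<phi> f"
  shows "simulates (search_stage \<phi>) (\<lambda>p xs. minimize (\<lambda>n. f p (n # xs)))"
proof (rule simulatesI)
  fix w s xs n p assume v: "search_stage \<phi> w s xs = Suc n" and w: "agrees w s p"
  have "n = scan (\<lambda>n. 1 < \<phi> w s (n # xs)) s" "\<phi> w s (n # xs) = Suc 0"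
    using v by (auto simp: search_stage_def Let_def split: if_splits)
  then have zero: "\<phi> w s (n # xs) = Suc 0" and pos: "\<forall>m<n. 1 < \<phi> w s (m # xs)"
    using scan[of "\<lambda>n. 1 < \<phi> w s (n # xs)" s] by auto
  have "\<exists>v. f p (m # xs) = Some (Suc v)" if "m < n" for m
  proof -
    have "\<phi> w s (m # xs) = Suc (Suc (\<phi> w s (m # xs) - 2))" using pos that by fastforce
    then show ?thesis using simulates_sound[OF \<phi>, OF _ w] by blast
  qed
  then have "least_zero (\<lambda>n. f p (n # xs)) n"
    using simulates_sound[OF \<phi>, OF zero w] by (simp add: least_zero_def)
  then show "minimize (\<lambda>n. f p (n # xs)) = Some n" by (simp add: minimize_eq_Some_iff)
next
  fix p xs n assume "minimize (\<lambda>n. f p (n # xs)) = Some n"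
  then have zero: "f p (n # xs) = Some 0" and pos: "\<And>m. m < n \<Longrightarrow> \<exists>v. f p (m # xs) = Some (Suc v)"
    by (auto simp: minimize_eq_Some_iff least_zero_def)
  have "\<forall>\<^sub>F s in sequentially. \<forall>m\<in>{..<n}. \<forall>w. agrees w s p \<longrightarrow> 1 < \<phi> w s (m # xs)"
  proof (intro eventually_ball_finite ballI)
    fix m assume "m \<in> {..<n}"
    then obtain v where "f p (m # xs) = Some (Suc v)" using pos[of m] by auto
    from simulates_complete[OF \<phi>, OF this]
    show "\<forall>\<^sub>F s in sequentially. \<forall>w. agrees w s p \<longrightarrow> 1 < \<phi> w s (m # xs)"
      by (rule eventually_mono) simp
  qed simp
  moreover have "\<forall>\<^sub>F s in sequentially. n < s" by (rule eventually_gt_at_top)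
  ultimately show "\<forall>\<^sub>F s in sequentially. \<forall>w. agrees w s p \<longrightarrow> search_stage \<phi> w s xs = Suc n"
    using simulates_complete[OF \<phi>, OF zero]
  proof eventually_elim
    case (elim s)
    show ?case
    proof (intro allI impI)
      fix w assume w: "agrees w s p"
      let ?P = "\<lambda>n. 1 < \<phi> w s (n # xs)"
      have m: "?P m" if "m < n" for m using elim(1) w that by blast
      have 1: "\<phi> w s (n # xs) = 1" using elim(3)[rule_format, OF w] by simp
      have "\<not> n < scan ?P s" using scan[of ?P s] 1 by (metis less_irrefl)
      moreover have "\<not> scan ?P s < n" using scan[of ?P s] m elim(2) by (meson less_trans)
      ultimately have "scan ?P s = n" by simp
      then show "search_stage \<phi> w s xs = Suc n" using 1 elim(2) by (simp add: search_stage_def)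
    qed
  qed
qed

text \<open>
  Kleene's normal form with bounded use of the oracle: each functional has its own total recursive
  approximation, built along its derivation.
\<close>

theorem partial_recursive_simulation:
  assumes "partial_recursive \<Phi>"
  shows "\<exists>\<phi>. recursive_stage \<phi> \<and> simulates \<phi> \<Phi>"
  using assms
proof (induction rule: partial_recursive.induct)
  case zero
  have "recursive_stage (\<lambda>w s xs. 1)" unfolding recursive_stage_def by (intro recursive_intros)
  then show ?case using simulation_zero by blast
next
  case succ
  have "recursive_stage (\<lambda>w s xs. case xs of [] \<Rightarrow> 0 | x # _ \<Rightarrow> Suc (Suc x))"
    unfolding recursive_stage_def case_list_decode by (intro recursive_intros)
  then show ?case using simulation_succ by blast
next
  case (proj i)
  have "recursive_stage (\<lambda>w s xs. if i < length xs then Suc (xs ! i) else 0)"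
    unfolding recursive_stage_def nth_list_decode by (intro recursive_intros)
  then show ?case using simulation_proj by blast
next
  case query
  have "recursive_stage (\<lambda>w s xs. case xs of [] \<Rightarrow> 0 | x # _ \<Rightarrow> if x < s then Suc (digit w x) else 0)"
    unfolding recursive_stage_def case_list_decode by (intro recursive_intros)
  then show ?case using simulation_query by blast
next
  case (comp f gs)
  obtain \<phi> where \<phi>: "recursive_stage \<phi>" "simulates \<phi> f" using comp.IH by blast
  have "\<forall>g\<in>set gs. \<exists>\<sigma>. recursive_stage \<sigma> \<and> simulates \<sigma> g" using comp.IH by blast
  from bchoice[OF this] obtain \<sigma> where \<sigma>: "\<forall>g\<in>set gs. recursive_stage (\<sigma> g) \<and> simulates (\<sigma> g) g" by blast
  have code: "recursive (\<lambda>p x. list_encode (map (\<lambda>g. \<sigma> g (pfst x) (pfst (psnd x)) (list_decode (psnd (psnd x))) - 1) hs))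
      \<and> decidable (\<lambda>p x. \<exists>g\<in>set hs. \<sigma> g (pfst x) (pfst (psnd x)) (list_decode (psnd (psnd x))) = 0)"
    if "set hs \<subseteq> set gs" for hs
    using that
  proof (induction hs)
    case Nil
    have "decidable (\<lambda>p x. 0 < (0::nat))" by (intro recursive_intros)
    then show ?case by (simp add: recursive_intros)
  next
    case (Cons g hs)
    have "recursive_stage (\<sigma> g)" using Cons.prems \<sigma> by simp
    note stage = recursive_stageD[OF this]
    have "recursive (\<lambda>p x. Suc (prod_encode (\<sigma> g (pfst x) (pfst (psnd x)) (list_decode (psnd (psnd x))) - 1,
        list_encode (map (\<lambda>g. \<sigma> g (pfst x) (pfst (psnd x)) (list_decode (psnd (psnd x))) - 1) hs))))"
      using Cons by (intro recursive_intros stage) simp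
    moreover have "decidable (\<lambda>p x. \<sigma> g (pfst x) (pfst (psnd x)) (list_decode (psnd (psnd x))) = 0 \<or>
        (\<exists>g\<in>set hs. \<sigma> g (pfst x) (pfst (psnd x)) (list_decode (psnd (psnd x))) = 0))"
      using Cons by (intro decidable_logic decidable_eq_0 recursive_intros stage) simp
    ultimately show ?case by simp
  qed
  have "recursive_stage (comp_stage \<phi> gs \<sigma>)"
  proof -
    have "recursive (\<lambda>p x. if \<exists>g\<in>set gs. \<sigma> g (pfst x) (pfst (psnd x)) (list_decode (psnd (psnd x))) = 0 then 0
        else \<phi> (pfst x) (pfst (psnd x)) (list_decode (list_encode
          (map (\<lambda>g. \<sigma> g (pfst x) (pfst (psnd x)) (list_decode (psnd (psnd x))) - 1) gs))))"
      using code[OF subset_refl] by (intro recursive_if recursive_stageD[OF \<phi>(1)] recursive_intros; simp)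
    then show ?thesis unfolding recursive_stage_def comp_stage_def by (simp only: list_encode_inverse)
  qed
  then show ?case using simulation_comp[OF \<phi>(2)] \<sigma> by blast
next
  case (prim_rec f g)
  obtain \<phi> \<gamma> where \<phi>: "recursive_stage \<phi>" "simulates \<phi> f" and \<gamma>: "recursive_stage \<gamma>" "simulates \<gamma> g"
    using prim_rec.IH by blast
  have Cons2: "k # r # list_decode c = list_decode (Suc (prod_encode (k, Suc (prod_encode (r, c)))))" for k r c
    by simp
  have "recursive_stage (prim_rec_stage \<phi> \<gamma>)"
    unfolding recursive_stage_def prim_rec_stage_def case_list_decode Cons2
    by (intro recursive_intros decidable_eq_0 recursive_stageD[OF \<phi>(1)] recursive_stageD[OF \<gamma>(1)])
  then show ?case using simulation_prim_rec[OF \<phi>(2) \<gamma>(2)] by blast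
next
  case (search f)
  obtain \<phi> where \<phi>: "recursive_stage \<phi>" "simulates \<phi> f" using search.IH by blast
  have Cons1: "k # list_decode c = list_decode (Suc (prod_encode (k, c)))" for k c by simp
  have "recursive_stage (search_stage \<phi>)"
    unfolding recursive_stage_def search_stage_def scan_def Let_def Cons1
    by (intro recursive_intros decidable_eq_0 recursive_stageD[OF \<phi>(1)])
  then show ?case using simulation_search[OF \<phi>(2)] by blast
qed

section \<open>Compactness of Cantor space\<close>

lemma compact_product_of_finite:
  assumes "\<And>k. finite (S k)"
  shows "compact {b :: baire. \<forall>k. b k \<in> S k}"
proof -
  have "compactin (product_topology (\<lambda>k. euclidean) UNIV) (PiE UNIV S)"
    using assms by (auto simp: compactin_PiE finite_imp_compact)
  moreover have "PiE UNIV S = {b. \<forall>k. b k \<in> S k}" by (auto simp: PiE_def)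
  ultimately show ?thesis by (simp add: euclidean_product_topology)
qed

lemma compact_cantor: "compact cantor"
  unfolding cantor_def by (rule compact_product_of_finite) simp

lemma digit_lt_2: "digit w i < 2"
  by (simp add: digit_def)

lemma digit_in_cantor: "digit w \<in> cantor"
  using digit_lt_2 by (auto simp: cantor_def less_2_cases_iff)

lemma cantor_prefix_code:
  assumes "b \<in> cantor"
  shows "\<exists>w<2 ^ L. agrees w L b"
  using assms
proof (induction L arbitrary: b)
  case 0
  show ?case by (auto simp: agrees_def)
next
  case (Suc L)
  have "(\<lambda>i. b (Suc i)) \<in> cantor" using Suc.prems by (simp add: cantor_def)
  then obtain w where w: "w < 2 ^ L" "agrees w L (\<lambda>i. b (Suc i))" using Suc.IH by blast
  have b0: "b 0 < 2" using Suc.prems by (auto simp: cantor_def less_2_cases_iff)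
  have "digit (b 0 + 2 * w) i = b i" if "i < Suc L" for i
  proof (cases i)
    case 0
    then show ?thesis using b0 by (simp add: digit_def)
  next
    case (Suc j)
    have "(b 0 + 2 * w) div 2 ^ Suc j = w div 2 ^ j" using b0 by (simp add: div_mult2_eq)
    then show ?thesis using w(2) Suc that by (simp add: agrees_def digit_def)
  qed
  moreover have "b 0 + 2 * w < 2 ^ Suc L" using b0 w(1) by simp
  ultimately show ?case by (auto simp: agrees_def)
qed

text \<open>
  If each binary sequence has a witness that a finite prefix of it already certifies, then the
  witnesses are bounded uniformly, by compactness of Cantor space. A witness \<^term>\<open>u\<close> may
  depend on the digits up to and including position \<^term>\<open>u\<close>; codes of tuples bound their
  components, so this is enough for every use below.
\<close>

lemma fan_principle:
  assumes bar: "\<And>b. b \<in> cantor \<Longrightarrow> \<exists>u. \<forall>w. agrees w (Suc u) b \<longrightarrow> good w u"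
  shows "\<exists>L. \<forall>w<2 ^ L. \<exists>u<L. good w u"
proof -
  define U where "U u = {b. \<forall>w. agrees w (Suc u) b \<longrightarrow> good w u}" for u
  have "open (U u)" for u
    unfolding open_subopen[of "U u"]
  proof
    fix b assume b: "b \<in> U u"
    let ?N = "PiE UNIV (\<lambda>i. if i < Suc u then {b i} else UNIV)"
    have "finite {i. (if i < Suc u then {b i} else UNIV) \<noteq> UNIV}"
      by (rule finite_subset[of _ "{..<Suc u}"]) auto
    then have "open ?N" by (intro open_PiE) (auto intro: open_discrete)
    moreover have "b \<in> ?N" by (auto simp: PiE_def)
    moreover have "?N \<subseteq> U u"
    proof
      fix a assume a: "a \<in> ?N"
      have "a i = b i" if "i < Suc u" for i
        using PiE_mem[OF a, of i] that by simp
      then have "agrees w (Suc u) a \<longleftrightarrow> agrees w (Suc u) b" for w by (auto simp: agrees_def)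
      then show "a \<in> U u" using b by (simp add: U_def)
    qed
    ultimately show "\<exists>T. open T \<and> b \<in> T \<and> T \<subseteq> U u" by blast
  qed
  moreover have "cantor \<subseteq> (\<Union>u\<in>UNIV. U u)" using bar by (auto simp: U_def)
  ultimately obtain I where I: "finite I" "cantor \<subseteq> (\<Union>u\<in>I. U u)"
    using compactE_image[OF compact_cantor, of UNIV U] by metis
  obtain L where L: "I \<subseteq> {..<L}" using finite_nat_bounded[OF I(1)] by blast
  have "\<exists>u<L. good w u" for w
  proof -
    obtain u where "u \<in> I" "digit w \<in> U u" using I(2) digit_in_cantor by blast
    then show ?thesis using L by (auto simp: U_def agrees_def)
  qed
  then show ?thesis by blast
qed

section \<open>Solutions of parallel LLPO as a compact set\<close>

lemma LLPO_iff:
  assumes "p \<in> mdom LLPO"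
  shows "i \<in> LLPO p \<longleftrightarrow> i < 2 \<and> (\<forall>j. p (2 * j + i) = 0)"
proof -
  have "\<forall>k l. p k \<noteq> 0 \<and> p l \<noteq> 0 \<longrightarrow> k = l"
    using assms unfolding mdom_def LLPO_def by (auto split: if_splits)
  then show ?thesis unfolding LLPO_def by (auto simp: less_2_cases_iff)
qed

text \<open>
  The solutions are the binary sequences that pass countably many tests, and each test inspects one
  digit. This makes it semidecidable that a sequence is not a solution.
\<close>

lemma LLPO_hat_iff:
  assumes "q \<in> mdom LLPO_hat"
  shows "b \<in> LLPO_hat q \<longleftrightarrow> b \<in> cantor \<and> (\<forall>k j. q (prod_encode (k, 2 * j + b k)) = 0)"
proof -
  have "component q k \<in> mdom LLPO" for k
    using assms unfolding LLPO_hat_def mdom_def by auto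
  then show ?thesis
    unfolding LLPO_hat_def cantor_def
    by (auto simp: LLPO_iff component_def less_2_cases_iff)
qed

text \<open>
  The set of solutions is a product of finite sets.
\<close>

lemma compact_LLPO_hat:
  assumes "q \<in> mdom LLPO_hat"
  shows "compact (LLPO_hat q)"
proof -
  have "component q k \<in> mdom LLPO" for k
    using assms unfolding LLPO_hat_def mdom_def by auto
  then have "LLPO_hat q = {b. \<forall>k. b k \<in> LLPO (component q k)}" by (simp add: LLPO_hat_def)
  moreover have "finite (LLPO p)" for p
    by (rule finite_subset[of _ "{0, 1}"]) (auto simp: LLPO_def split: if_splits)
  ultimately show ?thesis using compact_product_of_finite by simp
qed

lemma agrees_mono: "agrees w t b \<Longrightarrow> s \<le> t \<Longrightarrow> agrees w s b"
  by (auto simp: agrees_def)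

section \<open>Parallel LLPO by compact choice in a computable copy of Cantor space\<close>

text \<open>
  What the converse reduction uses of a computable embedding: topologically an injective continuous
  map, and effectively stages that approximate the image up to \<open>2\<^sup>-\<^sup>n\<close> from a finite prefix of the
  argument.
\<close>

locale computable_cantor_copy = approximated_metric \<alpha> c
  for \<alpha> :: "nat \<Rightarrow> 'a::metric_space" and c +
  fixes \<iota> :: "baire \<Rightarrow> 'a" and \<phi> :: "nat \<Rightarrow> nat \<Rightarrow> nat list \<Rightarrow> nat"
  assumes inj: "inj_on \<iota> cantor" and cont: "continuous_on cantor \<iota>"
    and stage: "recursive_stage \<phi>"
    and stage_sound: "\<lbrakk>b \<in> cantor; agrees w s b; \<phi> w s [n] = Suc v\<rbrakk> \<Longrightarrow> dist (\<alpha> v) (\<iota> b) \<le> (1 / 2) ^ n"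
    and stage_complete: "b \<in> cantor \<Longrightarrow> \<exists>s v. \<forall>w. agrees w s b \<longrightarrow> \<phi> w s [n] = Suc v"
begin

lemma recursive_stage_singleton [recursive_intros]:
  assumes "recursive w" "recursive s" "recursive n"
  shows "recursive (\<lambda>p x. \<phi> (w p x) (s p x) [n p x])"
proof -
  have eq: "[m] = list_decode (Suc (prod_encode (m, 0)))" for m by simp
  show ?thesis unfolding eq by (intro recursive_stageD[OF stage] recursive_intros assms)
qed

text \<open>
  Two witnesses for a finite prefix \<^term>\<open>w\<close>: \<open>u = \<langle>k, j\<rangle>\<close> shows that no solution starts with it,
  and \<open>u = \<langle>s, \<langle>n, m\<rangle>\<rangle>\<close> shows that the image of its cylinder lies in a ball of
  the family \<^term>\<open>g\<close>: stage \<^term>\<open>s\<close> yields a centre within \<open>2\<^sup>-\<^sup>n\<close> of the image points, which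
  precision \<^term>\<open>m\<close> places inside a ball by more than \<open>2\<^sup>-\<^sup>n\<close>.
\<close>

definition removed :: "baire \<Rightarrow> nat \<Rightarrow> nat \<Rightarrow> bool" where
  "removed q w u \<longleftrightarrow> q (prod_encode (pfst u, 2 * psnd u + digit w (pfst u))) \<noteq> 0"

definition inside :: "nat \<Rightarrow> nat \<Rightarrow> nat \<Rightarrow> bool" where
  "inside g w u \<longleftrightarrow> \<phi> w (pfst u) [pfst (psnd u)] \<noteq> 0 \<and>
     (\<exists>d\<in>set (list_decode g). surely_within c (psnd (psnd u)) (\<phi> w (pfst u) [pfst (psnd u)] - 1) (pfst d)
        (Suc (pfst (psnd d)) * 2 ^ pfst (psnd u)) (Suc (psnd (psnd d))) (Suc (psnd (psnd d)) * 2 ^ pfst (psnd u)))"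

definition covered :: "baire \<Rightarrow> nat \<Rightarrow> nat \<Rightarrow> bool" where
  "covered q g L \<longleftrightarrow> (\<forall>w<2 ^ L. \<exists>u<L. removed q w u \<or> inside g w u)"

text \<open>
  The witness \<open>u = \<langle>s, \<langle>n, m\<rangle>\<rangle>\<close> shows that the point with Cauchy name \<^term>\<open>y\<close> is not in the image
  of the cylinder of \<^term>\<open>w\<close>: their \<^term>\<open>n\<close>-th approximations have distance
  more than \<open>2 * 2\<^sup>-\<^sup>n\<close>.
\<close>

definition apart :: "baire \<Rightarrow> nat \<Rightarrow> nat \<Rightarrow> bool" where
  "apart y w u \<longleftrightarrow> \<phi> w (pfst u) [pfst (psnd u)] \<noteq> 0 \<and>
     surely_beyond c (psnd (psnd u)) (\<phi> w (pfst u) [pfst (psnd u)] - 1) (y (pfst (psnd u))) 2 (2 ^ pfst (psnd u))"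

text \<open>
  At level \<^term>\<open>L\<close> it is certain that digit \<^term>\<open>k\<close> of the preimage is not \<^term>\<open>e\<close>, because the cylinders of
  all prefixes with that digit have images apart from the point.
\<close>

definition excluded :: "baire \<Rightarrow> nat \<Rightarrow> nat \<Rightarrow> nat \<Rightarrow> bool" where
  "excluded y k e L \<longleftrightarrow> (\<forall>w<2 ^ L. \<exists>u<L. u = k \<and> digit w k \<noteq> e \<or> apart y w u)"

lemma inside_threshold:
  "(real (Suc (pfst (psnd d)) * 2 ^ n) - real (Suc (psnd (psnd d)))) / real (Suc (psnd (psnd d)) * 2 ^ n)
     = radius d - (1 / 2) ^ n"
proof -
  have "(s * m - r) / (r * m) = s / r - 1 / m" if "r > 0" "m > 0" for r s m :: real
    using that by (simp add: field_simps)
  from this[of "real (Suc (psnd (psnd d)))" "2 ^ n" "real (Suc (pfst (psnd d)))"]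
  show ?thesis by (simp add: radius_def power_one_over del: of_nat_Suc mult_Suc)
qed

lemma inside_sound:
  assumes "inside g w u" and b: "b \<in> cantor" "agrees w u b"
  shows "\<iota> b \<in> family_union \<alpha> g"
proof -
  define v n where "v = \<phi> w (pfst u) [pfst (psnd u)] - 1" and "n = pfst (psnd u)"
  obtain d where v: "\<phi> w (pfst u) [n] = Suc v" and d: "d \<in> set (list_decode g)"
    and within: "surely_within c (psnd (psnd u)) v (pfst d)
        (Suc (pfst (psnd d)) * 2 ^ n) (Suc (psnd (psnd d))) (Suc (psnd (psnd d)) * 2 ^ n)"
    using assms(1) unfolding inside_def v_def n_def by auto
  have "pfst u \<le> u" using le_prod_encode_1[of "pfst u" "psnd u"] by simp
  then have "dist (\<alpha> v) (\<iota> b) \<le> (1 / 2) ^ n"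
    using stage_sound[OF b(1) agrees_mono[OF b(2)] v] by simp
  moreover have "dist (\<alpha> v) (\<alpha> (pfst d)) < radius d - (1 / 2) ^ n"
    using surely_withinD[OF within] unfolding inside_threshold .
  ultimately have "dist (\<alpha> (pfst d)) (\<iota> b) < radius d"
    using dist_triangle3[of "\<alpha> (pfst d)" "\<iota> b" "\<alpha> v"] by linarith
  then show ?thesis using d by (auto simp: family_union_def rational_ball_radius)
qed

lemma inside_complete:
  assumes b: "b \<in> cantor" and g: "\<iota> b \<in> family_union \<alpha> g"
  shows "\<exists>u. \<forall>w. agrees w (Suc u) b \<longrightarrow> inside g w u"
proof -
  obtain d where d: "d \<in> set (list_decode g)" "dist (\<alpha> (pfst d)) (\<iota> b) < radius d"
    using g by (auto simp: family_union_def rational_ball_radius)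
  \<comment> \<open>The room left in the ball is used twice: for the error of the centre and for the required margin.\<close>
  define \<delta> where "\<delta> = (radius d - dist (\<alpha> (pfst d)) (\<iota> b)) / 2"
  have "\<delta> > 0" using d(2) by (simp add: \<delta>_def)
  then obtain n where n: "(1 / 2) ^ n < \<delta>" using real_arch_pow_inv[of \<delta> "1 / 2"] by auto
  obtain s v where v: "\<And>w. agrees w s b \<Longrightarrow> \<phi> w s [n] = Suc v" using stage_complete[OF b] by metis
  obtain w where "agrees w s b" using cantor_prefix_code[OF b] by blast
  then have "dist (\<alpha> v) (\<iota> b) \<le> (1 / 2) ^ n" using stage_sound[OF b _ v] by blast
  moreover have "2 * \<delta> = radius d - dist (\<alpha> (pfst d)) (\<iota> b)" by (simp add: \<delta>_def)
  ultimately have "dist (\<alpha> v) (\<alpha> (pfst d)) < radius d - (1 / 2) ^ n"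
    using n dist_triangle2[of "\<alpha> v" "\<alpha> (pfst d)" "\<iota> b"] by linarith
  then have "\<forall>\<^sub>F m in sequentially. surely_within c m v (pfst d)
      (Suc (pfst (psnd d)) * 2 ^ n) (Suc (psnd (psnd d))) (Suc (psnd (psnd d)) * 2 ^ n)"
    unfolding inside_threshold[symmetric] by (rule eventually_surely_within)
  then obtain m where m: "surely_within c m v (pfst d)
      (Suc (pfst (psnd d)) * 2 ^ n) (Suc (psnd (psnd d))) (Suc (psnd (psnd d)) * 2 ^ n)"
    using eventually_happens'[OF sequentially_bot] by blast
  let ?u = "prod_encode (s, prod_encode (n, m))"
  have "inside g w ?u" if "agrees w (Suc ?u) b" for w
  proof -
    have "agrees w s b" using le_prod_encode_1[of s "prod_encode (n, m)"] by (intro agrees_mono[OF that]) simp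
    then show ?thesis using v m d(1) by (auto simp: inside_def)
  qed
  then show ?thesis by blast
qed

text \<open>
  The prefix of a solution is never ruled out, so the witness for it shows that the image of its
  cylinder lies in a ball of the family.
\<close>

lemma covered_sound:
  assumes q: "q \<in> mdom LLPO_hat" and b: "b \<in> LLPO_hat q" and g: "covered q g L"
  shows "\<iota> b \<in> family_union \<alpha> g"
proof -
  have bc: "b \<in> cantor" and zero: "\<And>k j. q (prod_encode (k, 2 * j + b k)) = 0"
    using b by (simp_all add: LLPO_hat_iff[OF q])
  obtain w where w: "w < 2 ^ L" "agrees w L b" using cantor_prefix_code[OF bc] by blast
  obtain u where u: "u < L" "removed q w u \<or> inside g w u" using g w(1) by (auto simp: covered_def)
  have "pfst u \<le> u" using le_prod_encode_1[of "pfst u" "psnd u"] by simp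
  then have "digit w (pfst u) = b (pfst u)" using w(2) u(1) by (simp add: agrees_def)
  then have "\<not> removed q w u" using zero by (simp add: removed_def)
  then show ?thesis using inside_sound[OF _ bc agrees_mono[OF w(2)]] u by auto
qed

text \<open>
  Each binary sequence either fails a test or has its image in an open ball of the family, and both
  are certified by a finite prefix; hence the fan principle applies.
\<close>

lemma covered_complete:
  assumes q: "q \<in> mdom LLPO_hat" and g: "\<iota> ` LLPO_hat q \<subseteq> family_union \<alpha> g"
  shows "\<exists>L. covered q g L"
  unfolding covered_def
proof (rule fan_principle)
  fix b assume b: "b \<in> cantor"
  show "\<exists>u. \<forall>w. agrees w (Suc u) b \<longrightarrow> removed q w u \<or> inside g w u"
  proof (cases "b \<in> LLPO_hat q")
    case True
    then show ?thesis using inside_complete[OF b, of g] g by blast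
  next
    case False
    then obtain k j where kj: "q (prod_encode (k, 2 * j + b k)) \<noteq> 0" using b by (auto simp: LLPO_hat_iff[OF q])
    have "removed q w (prod_encode (k, j))" if "agrees w (Suc (prod_encode (k, j))) b" for w
      using that kj le_prod_encode_1[of k j] by (auto simp: removed_def agrees_def)
    then show ?thesis by blast
  qed
qed

lemma excluded_sound:
  assumes y: "cauchy_name \<alpha> y (\<iota> b)" and b: "b \<in> cantor" and e: "excluded y k e L"
  shows "b k \<noteq> e"
proof -
  obtain w where w: "w < 2 ^ L" "agrees w L b" using cantor_prefix_code[OF b] by blast
  obtain u where u: "u < L" "u = k \<and> digit w k \<noteq> e \<or> apart y w u" using e w(1) by (auto simp: excluded_def)
  have "\<not> apart y w u"
  proof
    assume apart: "apart y w u"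
    define v n where "v = \<phi> w (pfst u) [pfst (psnd u)] - 1" and "n = pfst (psnd u)"
    have v: "\<phi> w (pfst u) [n] = Suc v"
      and beyond: "surely_beyond c (psnd (psnd u)) v (y n) 2 (2 ^ n)"
      using apart unfolding apart_def v_def n_def by auto
    have "pfst u \<le> L" using u(1) le_prod_encode_1[of "pfst u" "psnd u"] by simp
    then have "dist (\<alpha> v) (\<iota> b) \<le> (1 / 2) ^ n"
      using stage_sound[OF b agrees_mono[OF w(2)] v] by simp
    moreover have "dist (\<alpha> (y n)) (\<iota> b) \<le> (1 / 2) ^ n" by (rule cauchy_name_dist[OF y])
    ultimately have "dist (\<alpha> v) (\<alpha> (y n)) \<le> 2 * (1 / 2) ^ n"
      using dist_triangle2[of "\<alpha> v" "\<alpha> (y n)" "\<iota> b"] by simp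
    then show False using surely_beyondD[OF beyond] by (simp add: power_one_over)
  qed
  then show ?thesis using u w(2) by (auto simp: agrees_def)
qed

text \<open>
  The image of a sequence with the wrong digit differs from the point by injectivity. Its positive
  distance is noticed after a finite prefix, and by the fan principle uniformly.
\<close>

lemma excluded_complete:
  assumes y: "cauchy_name \<alpha> y (\<iota> b)" and b: "b \<in> cantor" and e: "b k \<noteq> e"
  shows "\<exists>L. excluded y k e L"
  unfolding excluded_def
proof (rule fan_principle)
  fix a assume a: "a \<in> cantor"
  show "\<exists>u. \<forall>w. agrees w (Suc u) a \<longrightarrow> u = k \<and> digit w k \<noteq> e \<or> apart y w u"
  proof (cases "a k = e")
    case False
    then show ?thesis by (intro exI[of _ k]) (auto simp: agrees_def)
  next
    case True
    then have "\<iota> a \<noteq> \<iota> b" using e inj a b by (auto dest: inj_onD)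
    \<comment> \<open>Two approximation errors and the required gap of twice that size: four times the error must fit.\<close>
    then have "dist (\<iota> a) (\<iota> b) / 4 > 0" by simp
    then obtain n where n: "(1 / 2) ^ n < dist (\<iota> a) (\<iota> b) / 4"
      using real_arch_pow_inv[of "dist (\<iota> a) (\<iota> b) / 4" "1 / 2"] by auto
    obtain s v where v: "\<And>w. agrees w s a \<Longrightarrow> \<phi> w s [n] = Suc v" using stage_complete[OF a] by metis
    obtain w where "agrees w s a" using cantor_prefix_code[OF a] by blast
    then have "dist (\<alpha> v) (\<iota> a) \<le> (1 / 2) ^ n" using stage_sound[OF a _ v] by blast
    moreover have "dist (\<alpha> (y n)) (\<iota> b) \<le> (1 / 2) ^ n" by (rule cauchy_name_dist[OF y])
    ultimately have "2 * (1 / 2) ^ n < dist (\<alpha> v) (\<alpha> (y n))"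
      using n dist_triangle3[of "\<iota> a" "\<iota> b" "\<alpha> v"] dist_triangle[of "\<alpha> v" "\<iota> b" "\<alpha> (y n)"] by linarith
    then have "\<forall>\<^sub>F m in sequentially. surely_beyond c m v (y n) 2 (2 ^ n)"
      by (intro eventually_surely_beyond) (simp add: power_one_over)
    then obtain m where m: "surely_beyond c m v (y n) 2 (2 ^ n)"
      using eventually_happens'[OF sequentially_bot] by blast
    let ?u = "prod_encode (s, prod_encode (n, m))"
    have "apart y w ?u" if "agrees w (Suc ?u) a" for w
    proof -
      have "agrees w s a" using le_prod_encode_1[of s "prod_encode (n, m)"] by (intro agrees_mono[OF that]) simp
      then show ?thesis using v m by (auto simp: apart_def)
    qed
    then show ?thesis by blast
  qed
qed

text \<open>
  All pairs of a family and a level are enumerated. The family \<^term>\<open>g\<close>, which covers the whole image of Cantor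
  space, fills the places of the pairs without success.
\<close>

definition cover_name :: "nat \<Rightarrow> baire \<Rightarrow> baire" where
  "cover_name g q x = (if covered q (pfst x) (psnd x) then pfst x else g)"

lemma compact_name_cover_name:
  assumes q: "q \<in> mdom LLPO_hat" and g: "\<iota> ` cantor \<subseteq> family_union \<alpha> g"
  shows "compact_name \<alpha> (cover_name g q) (\<iota> ` LLPO_hat q)"
proof -
  have sub: "LLPO_hat q \<subseteq> cantor" by (auto simp: LLPO_hat_iff[OF q])
  have "compact (\<iota> ` LLPO_hat q)"
    using compact_continuous_image[OF continuous_on_subset[OF cont sub] compact_LLPO_hat[OF q]] .
  moreover have "\<iota> ` LLPO_hat q \<subseteq> family_union \<alpha> (cover_name g q x)" for x
    using covered_sound[OF q] order_trans[OF image_mono[OF sub] g] by (auto simp: cover_name_def)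
  moreover have "h \<in> range (cover_name g q)" if h: "\<iota> ` LLPO_hat q \<subseteq> family_union \<alpha> h" for h
  proof -
    obtain L where "covered q h L" using covered_complete[OF q h] by blast
    then have "cover_name g q (prod_encode (h, L)) = h" by (simp add: cover_name_def)
    then show ?thesis by (metis rangeI)
  qed
  ultimately show ?thesis unfolding compact_name_def by auto
qed

text \<open>
  A candidate \<open>z = 2 * L + e\<close> is accepted if level \<^term>\<open>L\<close> excludes the digit other than \<^term>\<open>e\<close>.
\<close>

definition bit_found :: "baire \<Rightarrow> nat \<Rightarrow> nat \<Rightarrow> bool" where
  "bit_found y k z \<longleftrightarrow> excluded y k (1 - z mod 2) (z div 2)"

lemma bit_found_point:
  assumes y: "cauchy_name \<alpha> y (\<iota> b)" and b: "b \<in> cantor"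
  shows "\<exists>z. bit_found y k z" and "(LEAST z. bit_found y k z) mod 2 = b k"
proof -
  have bk: "b k < 2" using b by (auto simp: cantor_def less_2_cases_iff)
  then have "b k \<noteq> 1 - b k" by arith
  then obtain L where "excluded y k (1 - b k) L" using excluded_complete[OF y b] by blast
  then have "bit_found y k (2 * L + b k)" using bk by (simp add: bit_found_def)
  then show ex: "\<exists>z. bit_found y k z" ..
  define z where "z = (LEAST z. bit_found y k z)"
  have "bit_found y k z" unfolding z_def by (rule LeastI_ex[OF ex])
  then have "b k \<noteq> 1 - z mod 2" using excluded_sound[OF y b] by (simp add: bit_found_def)
  then show "(LEAST z. bit_found y k z) mod 2 = b k" using bk unfolding z_def[symmetric] by linarith
qed

lemma recursive_cover_name: "recursive (cover_name g)"
  unfolding cover_name_def covered_def removed_def inside_def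
  by (intro recursive_intros decidable_surely_within computable_dist) simp_all

lemma decidable_bit_found: "decidable (\<lambda>y x. bit_found y (pfst x) (psnd x))"
  unfolding bit_found_def excluded_def apart_def
  by (intro recursive_intros decidable_surely_beyond computable_dist) simp_all

theorem LLPO_hat_le_compact_choice:
  "sW_reducible baire_rep baire_rep LLPO_hat (compact_rep \<alpha>) (cauchy_rep \<alpha>) compact_choice"
proof -
  have "compact (\<iota> ` cantor)" by (rule compact_continuous_image[OF cont compact_cantor])
  then have "\<iota> ` cantor \<in> ran (compact_rep \<alpha>)" by (simp add: ran_compact_rep[OF dense])
  then obtain p where "compact_name \<alpha> p (\<iota> ` cantor)"
    by (auto simp: ran_def compact_rep_eq_Some_iff[OF dense])
  then have g: "\<iota> ` cantor \<subseteq> family_union \<alpha> (p 0)" unfolding compact_name_def by blast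
  let ?K = "\<lambda>q. Some (cover_name (p 0) q)"
  let ?H = "\<lambda>y. if \<forall>k. \<exists>z. bit_found y k z then Some (\<lambda>k. (LEAST z. bit_found y k z) mod 2) else None"
  have "computable_fun ?K" by (rule computable_fun_total[OF recursive_cover_name])
  moreover have "computable_fun ?H"
    by (rule computable_fun_search[OF decidable_bit_found, of "\<lambda>y k z. z mod 2"]) (intro recursive_intros)
  moreover have "realizer baire_rep baire_rep LLPO_hat (?H \<circ>\<^sub>m G \<circ>\<^sub>m ?K)"
    if G: "realizer (compact_rep \<alpha>) (cauchy_rep \<alpha>) compact_choice G" for G
    unfolding realizer_def
  proof (intro allI impI)
    fix q' q assume "baire_rep q' = Some q \<and> q \<in> mdom LLPO_hat"
    then have q: "q \<in> mdom LLPO_hat" and q': "q' = q" by (simp_all add: baire_rep_def)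
    note name = compact_name_cover_name[OF q g]
    have K: "compact_choice (\<iota> ` LLPO_hat q) = \<iota> ` LLPO_hat q"
      using name by (simp add: compact_choice_def compact_name_def)
    moreover have "LLPO_hat q \<noteq> {}" using q by (simp add: mdom_def)
    ultimately have "\<iota> ` LLPO_hat q \<in> mdom compact_choice" by (simp add: mdom_def)
    then obtain y x where y: "G (cover_name (p 0) q) = Some y" "cauchy_rep \<alpha> y = Some x"
      "x \<in> compact_choice (\<iota> ` LLPO_hat q)"
      using G name unfolding realizer_def compact_rep_eq_Some_iff[OF dense, symmetric] by blast
    then obtain b where b: "b \<in> LLPO_hat q" "x = \<iota> b" unfolding K by blast
    then have bc: "b \<in> cantor" by (simp add: LLPO_hat_iff[OF q])
    have "cauchy_name \<alpha> y (\<iota> b)" using y(2) b(2) by (simp add: cauchy_rep_eq_Some_iff)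
    note bits = bit_found_point[OF this bc]
    then have "(?H \<circ>\<^sub>m G \<circ>\<^sub>m ?K) q' = Some b" using y(1) by (simp add: map_comp_def q')
    then show "\<exists>r z. (?H \<circ>\<^sub>m G \<circ>\<^sub>m ?K) q' = Some r \<and> baire_rep r = Some z \<and> z \<in> LLPO_hat q"
      using b(1) by (simp add: baire_rep_def)
  qed
  ultimately show ?thesis unfolding sW_reducible_def by blast
qed

end

section \<open>Rich spaces\<close>

text \<open>
  The stages are those of a functional that computes a realizer of the embedding. Both names and
  points of Cantor space are binary sequences, so finite binary oracles are all that is needed.
\<close>

lemma rich_imp_LLPO_hat_le_compact_choice:
  assumes "approximated_metric \<alpha> c" "rich \<alpha>"
  shows "sW_reducible baire_rep baire_rep LLPO_hat (compact_rep \<alpha>) (cauchy_rep \<alpha>) compact_choice"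
proof -
  interpret approximated_metric \<alpha> c by fact
  obtain \<iota> where inj: "inj_on \<iota> cantor" and comp: "computable_map cantor_rep (cauchy_rep \<alpha>) \<iota>"
    and emb: "embedding_map (top_of_set cantor) euclidean \<iota>"
    using assms(2) unfolding rich_def computable_cantor_embedding_def by blast
  have cont: "continuous_on cantor \<iota>"
    using emb by (auto simp: embedding_map_def dest!: homeomorphic_imp_continuous_map)
  obtain F where F: "computable_fun F" "realizer cantor_rep (cauchy_rep \<alpha>) (\<lambda>x. {\<iota> x}) F"
    using comp unfolding computable_map_def by blast
  obtain \<Phi> where \<Phi>: "partial_recursive \<Phi>" "\<And>p q n. F p = Some q \<Longrightarrow> \<Phi> p [n] = Some (q n)"
    using F(1) unfolding computable_fun_def by blast
  obtain \<phi> where \<phi>: "recursive_stage \<phi>" "simulates \<phi> \<Phi>" using partial_recursive_simulation[OF \<Phi>(1)] by blast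
  have name: "\<exists>q. (\<forall>n. \<Phi> b [n] = Some (q n)) \<and> cauchy_name \<alpha> q (\<iota> b)" if "b \<in> cantor" for b
  proof -
    have "\<exists>q y. F b = Some q \<and> cauchy_rep \<alpha> q = Some y \<and> y \<in> {\<iota> b}"
      using F(2) that unfolding realizer_def cantor_rep_def mdom_def by auto
    then show ?thesis using \<Phi>(2) by (auto simp: cauchy_rep_eq_Some_iff)
  qed
  interpret computable_cantor_copy \<alpha> c \<iota> \<phi>
  proof
    show "inj_on \<iota> cantor" "continuous_on cantor \<iota>" "recursive_stage \<phi>" by fact+
  next
    fix b w s n v assume b: "b \<in> cantor" and w: "agrees w s b" and v: "\<phi> w s [n] = Suc v"
    obtain q where q: "\<forall>n. \<Phi> b [n] = Some (q n)" "cauchy_name \<alpha> q (\<iota> b)" using name[OF b] by blast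
    have "\<Phi> b [n] = Some v" by (rule simulates_sound[OF \<phi>(2), OF v w])
    then have "v = q n" using q(1) by simp
    then show "dist (\<alpha> v) (\<iota> b) \<le> (1 / 2) ^ n" using cauchy_name_dist[OF q(2)] by simp
  next
    fix b n assume b: "b \<in> cantor"
    then obtain v where v: "\<Phi> b [n] = Some v" using name[OF b] by blast
    have "\<forall>\<^sub>F s in sequentially. \<forall>w. agrees w s b \<longrightarrow> \<phi> w s [n] = Suc v"
      by (rule simulates_complete[OF \<phi>(2), OF v])
    then show "\<exists>s v. \<forall>w. agrees w s b \<longrightarrow> \<phi> w s [n] = Suc v"
      using eventually_happens'[OF sequentially_bot] by blast
  qed
  show ?thesis by (rule LLPO_hat_le_compact_choice)
qed

theorem theorem8p5:
  fixes \<alpha> :: "nat \<Rightarrow> 'a::metric_space"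
  assumes "computable_metric_space \<alpha>"
  shows "sW_reducible (compact_rep \<alpha>) (cauchy_rep \<alpha>) compact_choice baire_rep baire_rep LLPO_hat \<and>
    (rich \<alpha> \<longrightarrow>
      sW_equivalent (compact_rep \<alpha>) (cauchy_rep \<alpha>) compact_choice baire_rep baire_rep LLPO_hat)"
proof -
  obtain c where c: "approximated_metric \<alpha> c"
    using assms unfolding computable_metric_space_def computable_real_double_seq_def approximated_metric_def
    by blast
  note le = approximated_metric.compact_choice_le_LLPO_hat[OF c]
  then show ?thesis
    using rich_imp_LLPO_hat_le_compact_choice[OF c] unfolding sW_equivalent_def by blast
qed

end
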